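(* Let $n\ge 2$ and let $M$ be a complete immersed hypersurface in $\mathbb{H}^{n}\times\mathbb{R}$ with bounded mean curvature $\sup_{M}|H|\le (n-1)/n$, contained in a vertical cylinder (i.e. cylindrically bounded). Then $M$ is non-parabolic.
   Context: $\mathbb{H}^{n}$ is the $n$-dimensional hyperbolic space of constant sectional curvature $-1$, and $\mathbb{H}^{n}\times\mathbb{R}$ carries the product metric. $M$ is a connected $n$-dimensional manifold (without boundary) immersed in $\mathbb{H}^n\times\mathbb{R}$, with the induced Riemannian metric, and is complete in this metric. With $\alpha$ the second fundamental form and $\{e_1,\dots,e_n\}$ a local orthonormal frame of $M$, the mean curvature vector is $\vec{H}=\sum_{i=1}^{n}\alpha(e_i,e_i)$, and the mean curvature $H$ is normalized so that $\|\vec{H}\|=n|H|$. An immersed submanifold $M$ of $N\times\mathbb{R}$ is cylindrically bounded if $p(M)$ is a bounded subset of $N$, where $p:N\times\mathbb{R}\to N$, $p(x,t)=x$ (here $N=\mathbb{H}^n$). A Riemannian manifold is non-parabolic if it admits a non-constant subharmonic function that is bounded above (equivalently, a positive Green's function for the Laplacian). *)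

theory Defs
  imports "HOL-Analysis.Analysis"
begin

section \<open>Smooth maps between Euclidean spaces\<close>

text \<open>Both predicates are meant for an open set \<open>S\<close>; there, smoothness means that
  all iterated directional derivatives exist and are continuous.\<close>

primrec Ck_on :: "nat \<Rightarrow> 'a::euclidean_space set \<Rightarrow> ('a \<Rightarrow> 'b::euclidean_space) \<Rightarrow> bool" where
  "Ck_on 0 S f \<longleftrightarrow> continuous_on S f"
| "Ck_on (Suc k) S f \<longleftrightarrow> (\<forall>x\<in>S. f differentiable (at x)) \<and>
     (\<forall>v. Ck_on k S (\<lambda>x. frechet_derivative f (at x) v))"

definition smooth_on :: "'a::euclidean_space set \<Rightarrow> ('a \<Rightarrow> 'b::euclidean_space) \<Rightarrow> bool" where
  "smooth_on S f \<longleftrightarrow> (\<forall>k. Ck_on k S f)"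

section \<open>Smooth manifolds\<close>

text \<open>A chart is a domain together with a coordinate map; the dimension of the manifold is
  \<open>DIM('a)\<close>. An atlas need not be maximal.\<close>

type_synonym ('m, 'a) chart = "'m set \<times> ('m \<Rightarrow> 'a)"

abbreviation chart_image :: "('m, 'a) chart \<Rightarrow> 'a set" where
  "chart_image c \<equiv> snd c ` fst c"

text \<open>The coordinate expression of a map \<open>f\<close>, to be used on \<open>chart_image c\<close>.\<close>

definition local_rep :: "('m, 'a) chart \<Rightarrow> ('m \<Rightarrow> 'b) \<Rightarrow> 'a \<Rightarrow> 'b" where
  "local_rep c f = f \<circ> inv_into (fst c) (snd c)"

definition smooth_atlas :: "'m topology \<Rightarrow> ('m, 'a::euclidean_space) chart set \<Rightarrow> bool" where
  "smooth_atlas M A \<longleftrightarrow>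
     (\<Union>c\<in>A. fst c) = topspace M \<and>
     (\<forall>c\<in>A. openin M (fst c) \<and> open (chart_image c) \<and>
        homeomorphic_map (subtopology M (fst c)) (top_of_set (chart_image c)) (snd c)) \<and>
     (\<forall>c\<in>A. \<forall>d\<in>A. smooth_on (snd c ` (fst c \<inter> fst d)) (local_rep c (snd d)))"

definition smooth_manifold :: "'m topology \<Rightarrow> ('m, 'a::euclidean_space) chart set \<Rightarrow> bool" where
  "smooth_manifold M A \<longleftrightarrow> Hausdorff_space M \<and> second_countable M \<and> smooth_atlas M A"

definition Ck_function ::
  "nat \<Rightarrow> ('m, 'a::euclidean_space) chart set \<Rightarrow> ('m \<Rightarrow> real) \<Rightarrow> bool" where
  "Ck_function k A u \<longleftrightarrow> (\<forall>c\<in>A. Ck_on k (chart_image c) (local_rep c u))"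

text \<open>Some chart around \<open>p\<close>. It is only used to evaluate quantities at \<open>p\<close> whose value does not
  depend on the chart.\<close>

definition chart_at :: "('m, 'a) chart set \<Rightarrow> 'm \<Rightarrow> ('m, 'a) chart" where
  "chart_at A p = (SOME c. c \<in> A \<and> p \<in> fst c)"

section \<open>Riemannian metrics in coordinates\<close>

text \<open>On an open subset of a Euclidean space, \<open>g x v w\<close> is the inner product of the
  tangent vectors \<open>v\<close> and \<open>w\<close> at the point \<open>x\<close>.\<close>

type_synonym 'a metric = "'a \<Rightarrow> 'a \<Rightarrow> 'a \<Rightarrow> real"

text \<open>The Levi-Civita connection is \<open>\<nabla>\<^sub>v W = DW v + christoffel g x v W\<close>. For constant fields the
  Koszul formula (in which all brackets vanish) determines the second term.\<close>

definition christoffel :: "'a::euclidean_space metric \<Rightarrow> 'a \<Rightarrow> 'a \<Rightarrow> 'a \<Rightarrow> 'a" where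
  "christoffel g x v w = (THE z. \<forall>u. 2 * g x z u =
       frechet_derivative (\<lambda>y. g y w u) (at x) v
     + frechet_derivative (\<lambda>y. g y v u) (at x) w
     - frechet_derivative (\<lambda>y. g y v w) (at x) u)"

definition second_derivative ::
  "('a::euclidean_space \<Rightarrow> 'b::euclidean_space) \<Rightarrow> 'a \<Rightarrow> 'a \<Rightarrow> 'a \<Rightarrow> 'b" where
  "second_derivative f x v w =
     frechet_derivative (\<lambda>y. frechet_derivative f (at y) w) (at x) v"

definition hessian :: "'a::euclidean_space metric \<Rightarrow> ('a \<Rightarrow> real) \<Rightarrow> 'a \<Rightarrow> 'a \<Rightarrow> 'a \<Rightarrow> real" where
  "hessian g f x v w =
     second_derivative f x v w - frechet_derivative f (at x) (christoffel g x v w)"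

definition orthonormal_basis ::
  "('a::euclidean_space \<Rightarrow> 'a \<Rightarrow> real) \<Rightarrow> 'a set \<Rightarrow> bool" where
  "orthonormal_basis b E \<longleftrightarrow> finite E \<and> card E = DIM('a) \<and>
     (\<forall>e\<in>E. \<forall>e'\<in>E. b e e' = (if e = e' then 1 else 0))"

text \<open>For an inner product \<open>b\<close> and a bilinear \<open>T\<close> the sum does not depend on the chosen
  orthonormal basis.\<close>

definition metric_trace ::
  "('a::euclidean_space \<Rightarrow> 'a \<Rightarrow> real) \<Rightarrow> ('a \<Rightarrow> 'a \<Rightarrow> 'b::real_vector) \<Rightarrow> 'b" where
  "metric_trace b T = (\<Sum>e\<in>(SOME E. orthonormal_basis b E). T e e)"

section \<open>Riemannian manifolds\<close>

text \<open>A Riemannian metric on a manifold is given by its coordinate expressions \<open>g c\<close> on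
  \<open>chart_image c\<close>, for every chart \<open>c\<close> of the atlas.\<close>

type_synonym ('m, 'a) manifold_metric = "('m, 'a) chart \<Rightarrow> 'a metric"

definition laplacian ::
  "('m, 'a::euclidean_space) chart set \<Rightarrow> ('m, 'a) manifold_metric \<Rightarrow> ('m \<Rightarrow> real) \<Rightarrow> 'm \<Rightarrow> real" where
  "laplacian A g u p =
     (let c = chart_at A p; x = snd c p
      in metric_trace (g c x) (hessian (g c) (local_rep c u) x))"

definition subharmonic ::
  "'m topology \<Rightarrow> ('m, 'a::euclidean_space) chart set \<Rightarrow> ('m, 'a) manifold_metric \<Rightarrow>
     ('m \<Rightarrow> real) \<Rightarrow> bool" where
  "subharmonic M A g u \<longleftrightarrow> Ck_function 2 A u \<and> (\<forall>p\<in>topspace M. laplacian A g u p \<ge> 0)"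

definition non_parabolic ::
  "'m topology \<Rightarrow> ('m, 'a::euclidean_space) chart set \<Rightarrow> ('m, 'a) manifold_metric \<Rightarrow> bool" where
  "non_parabolic M A g \<longleftrightarrow>
     (\<exists>u. subharmonic M A g u \<and> bdd_above (u ` topspace M) \<and> \<not> u constant_on topspace M)"

text \<open>One-sided derivatives at the break points are not required; the derivative may even blow
  up there. The length below is a Lebesgue integral with values in \<open>[0, \<infinity>]\<close>, so this does not
  change the infimum of the lengths.\<close>

definition piecewise_C1_curve ::
  "'m topology \<Rightarrow> ('m, 'a::euclidean_space) chart set \<Rightarrow> (real \<Rightarrow> 'm) \<Rightarrow> bool" where
  "piecewise_C1_curve M A \<gamma> \<longleftrightarrow> pathin M \<gamma> \<and>
     (\<exists>S. finite S \<and>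
        (\<forall>c\<in>A. (snd c \<circ> \<gamma>) C1_differentiable_on {t \<in> {0<..<1} - S. \<gamma> t \<in> fst c}))"

definition speed ::
  "('m, 'a::euclidean_space) chart set \<Rightarrow> ('m, 'a) manifold_metric \<Rightarrow> (real \<Rightarrow> 'm) \<Rightarrow> real \<Rightarrow> real" where
  "speed A g \<gamma> t =
     (let c = chart_at A (\<gamma> t); v = vector_derivative (snd c \<circ> \<gamma>) (at t)
      in sqrt (g c (snd c (\<gamma> t)) v v))"

definition curve_length ::
  "('m, 'a::euclidean_space) chart set \<Rightarrow> ('m, 'a) manifold_metric \<Rightarrow> (real \<Rightarrow> 'm) \<Rightarrow> ennreal" where
  "curve_length A g \<gamma> = (\<integral>\<^sup>+t\<in>{0..1}. ennreal (speed A g \<gamma> t) \<partial>lborel)"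

definition riemannian_dist ::
  "'m topology \<Rightarrow> ('m, 'a::euclidean_space) chart set \<Rightarrow> ('m, 'a) manifold_metric \<Rightarrow>
     'm \<Rightarrow> 'm \<Rightarrow> ennreal" where
  "riemannian_dist M A g p q =
     (INF \<gamma> \<in> {\<gamma>. piecewise_C1_curve M A \<gamma> \<and> \<gamma> 0 = p \<and> \<gamma> 1 = q}. curve_length A g \<gamma>)"

definition complete_riemannian ::
  "'m topology \<Rightarrow> ('m, 'a::euclidean_space) chart set \<Rightarrow> ('m, 'a) manifold_metric \<Rightarrow> bool" where
  "complete_riemannian M A g \<longleftrightarrow>
     (\<forall>s :: nat \<Rightarrow> 'm. range s \<subseteq> topspace M \<longrightarrow>
        (\<forall>\<epsilon>>0. \<exists>N. \<forall>m\<ge>N. \<forall>n\<ge>N. riemannian_dist M A g (s m) (s n) < \<epsilon>) \<longrightarrow>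
        (\<exists>p\<in>topspace M. \<forall>\<epsilon>>0. \<exists>N. \<forall>n\<ge>N. riemannian_dist M A g (s n) p < \<epsilon>))"

section \<open>Immersions into an open subset of a Euclidean space with a Riemannian metric\<close>

definition immersion ::
  "'m topology \<Rightarrow> ('m, 'a::euclidean_space) chart set \<Rightarrow> 'b::euclidean_space set \<Rightarrow> ('m \<Rightarrow> 'b) \<Rightarrow> bool" where
  "immersion M A W F \<longleftrightarrow> F ` topspace M \<subseteq> W \<and>
     (\<forall>c\<in>A. smooth_on (chart_image c) (local_rep c F) \<and>
        (\<forall>x\<in>chart_image c. inj (frechet_derivative (local_rep c F) (at x))))"

definition pullback_metric ::
  "'b::euclidean_space metric \<Rightarrow> ('a::euclidean_space \<Rightarrow> 'b) \<Rightarrow> 'a metric" where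
  "pullback_metric h \<psi> x v w =
     h (\<psi> x) (frechet_derivative \<psi> (at x) v) (frechet_derivative \<psi> (at x) w)"

definition induced_metric ::
  "'b::euclidean_space metric \<Rightarrow> ('m \<Rightarrow> 'b) \<Rightarrow> ('m, 'a::euclidean_space) manifold_metric" where
  "induced_metric h F c = pullback_metric h (local_rep c F)"

text \<open>The component of \<open>X\<close> orthogonal to the subspace \<open>T\<close>.\<close>

definition normal_part :: "('b::euclidean_space \<Rightarrow> 'b \<Rightarrow> real) \<Rightarrow> 'b set \<Rightarrow> 'b \<Rightarrow> 'b" where
  "normal_part b T X = (THE N. X - N \<in> T \<and> (\<forall>Y\<in>T. b N Y = 0))"

text \<open>For a parametrisation \<open>\<psi>\<close>, the normal part of the ambient covariant derivative, in the
  direction \<open>v\<close>, of the field \<open>D\<psi> w\<close> along \<open>\<psi>\<close>.\<close>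

definition second_fundamental_form ::
  "'b::euclidean_space metric \<Rightarrow> ('a::euclidean_space \<Rightarrow> 'b) \<Rightarrow> 'a \<Rightarrow> 'a \<Rightarrow> 'a \<Rightarrow> 'b" where
  "second_fundamental_form h \<psi> x v w =
     normal_part (h (\<psi> x)) (range (frechet_derivative \<psi> (at x)))
       (second_derivative \<psi> x v w +
        christoffel h (\<psi> x) (frechet_derivative \<psi> (at x) v) (frechet_derivative \<psi> (at x) w))"

definition mean_curvature_vector ::
  "('m, 'a::euclidean_space) chart set \<Rightarrow> 'b::euclidean_space metric \<Rightarrow> ('m \<Rightarrow> 'b) \<Rightarrow> 'm \<Rightarrow> 'b" where
  "mean_curvature_vector A h F p =
     (let c = chart_at A p; x = snd c p; \<psi> = local_rep c F
      in metric_trace (pullback_metric h \<psi> x) (second_fundamental_form h \<psi> x))"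

text \<open>The absolute value \<open>|H|\<close> of the mean curvature, normalised by \<open>\<parallel>mean curvature vector\<parallel> = n |H|\<close>.
  The sign of \<open>H\<close> would depend on a local choice of unit normal.\<close>

definition abs_mean_curvature ::
  "('m, 'a::euclidean_space) chart set \<Rightarrow> 'b::euclidean_space metric \<Rightarrow> ('m \<Rightarrow> 'b) \<Rightarrow> 'm \<Rightarrow> real" where
  "abs_mean_curvature A h F p =
     (let V = mean_curvature_vector A h F p in sqrt (h (F p) V V) / real DIM('a))"

section \<open>The product of hyperbolic space and the real line\<close>

text \<open>Hyperbolic space of dimension \<open>DIM('a)\<close> and curvature \<open>-1\<close> in the Poincare ball model.\<close>

definition hyp_space :: "'a::euclidean_space set" where
  "hyp_space = ball 0 1"

definition hyp_metric :: "'a::euclidean_space metric" where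
  "hyp_metric x v w = 4 / (1 - (norm x)\<^sup>2)\<^sup>2 * (v \<bullet> w)"

definition hyp_dist :: "'a::euclidean_space \<Rightarrow> 'a \<Rightarrow> ennreal" where
  "hyp_dist = riemannian_dist (top_of_set hyp_space) {(hyp_space, id)} (\<lambda>_. hyp_metric)"

definition hyp_line :: "('a::euclidean_space \<times> real) set" where
  "hyp_line = hyp_space \<times> UNIV"

definition hyp_line_metric :: "('a::euclidean_space \<times> real) metric" where
  "hyp_line_metric z v w = hyp_metric (fst z) (fst v) (fst w) + snd v * snd w"

definition cylindrically_bounded ::
  "'m topology \<Rightarrow> ('m \<Rightarrow> 'a::euclidean_space \<times> real) \<Rightarrow> bool" where
  "cylindrically_bounded M F \<longleftrightarrow>
     (\<exists>x\<^sub>0\<in>hyp_space. \<exists>R::real. \<forall>y \<in> fst ` F ` topspace M. hyp_dist x\<^sub>0 y \<le> ennreal R)"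

end

theory Submission
  imports Defs
begin

text \<open>Let \<open>r\<close> be the hyperbolic distance to a fixed point \<open>o\<close>, pulled back to the hypersurface by the
  projection to hyperbolic space. The function \<open>cosh r\<close> is the required bounded, non-constant
  subharmonic function. Its Hessian on hyperbolic space is \<open>cosh r\<close> times the metric, so for a local
  orthonormal frame \<open>e\<^sub>1, \<dots>, e\<^sub>n\<close> of the hypersurface
  \<open>\<Delta> cosh r = cosh r (n - \<Sigma>\<langle>e\<^sub>i, \<partial>\<^sub>t\<rangle>\<^sup>2) + \<langle>grad cosh r, H\<rangle>\<close> with \<open>H\<close> the mean curvature vector.
  The vertical unit field satisfies \<open>\<Sigma>\<langle>e\<^sub>i, \<partial>\<^sub>t\<rangle>\<^sup>2 \<le> 1\<close>, the gradient has length \<open>sinh r\<close>, and the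
  length of \<open>H\<close> is at most \<open>n - 1\<close>. Hence \<open>\<Delta> cosh r \<ge> (n - 1) (cosh r - sinh r) > 0\<close>. A function
  with positive Laplacian is not constant, and \<open>cosh r\<close> is bounded because the hypersurface lies in a
  cylinder.

  Taking for \<open>o\<close> the centre of the Poincare ball makes \<open>cosh r\<close> the rational function
  \<open>(1 + \<bar>x\<bar>\<^sup>2) / (1 - \<bar>x\<bar>\<^sup>2)\<close>. The formula for the Laplacian comes from \<open>hessian_compose_immersion\<close>,
  which holds for any differentiable ambient metric and rests on the Gauss formula \<open>gauss_formula\<close>. The explicit
  hyperbolic computations are \<open>hessian_cosh_radius\<close> and \<open>cosh_radius_gradient_bound\<close>; they are
  assembled in \<open>trace_hessian_cosh_radius_pos\<close>. Boundedness is \<open>cosh_radius_bounded\<close>, which needs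
  that hyperbolic distance controls the Euclidean norm (\<open>hyp_dist_lower_bound\<close>).\<close>

section \<open>Inner products on a Euclidean space\<close>

definition inner_product :: "('b::euclidean_space \<Rightarrow> 'b \<Rightarrow> real) \<Rightarrow> bool" where
  "inner_product b \<longleftrightarrow> bilinear b \<and> (\<forall>v w. b v w = b w v) \<and> (\<forall>v. v \<noteq> 0 \<longrightarrow> b v v > 0)"

lemma bilinear_expand:
  fixes b :: "'b::euclidean_space \<Rightarrow> 'b \<Rightarrow> real"
  assumes "bilinear b"
  shows "b v w = (\<Sum>i\<in>Basis. \<Sum>j\<in>Basis. (v \<bullet> i) * (w \<bullet> j) * b i j)"
proof -
  have "b v w = b (\<Sum>i\<in>Basis. (v \<bullet> i) *\<^sub>R i) (\<Sum>j\<in>Basis. (w \<bullet> j) *\<^sub>R j)"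
    by (simp add: euclidean_representation)
  also have "\<dots> = (\<Sum>i\<in>Basis. \<Sum>j\<in>Basis. (v \<bullet> i) * (w \<bullet> j) * b i j)"
    by (simp add: bilinear_sum[OF assms] sum.cartesian_product bilinear_lmul[OF assms]
        bilinear_rmul[OF assms] ac_simps)
  finally show ?thesis .
qed

text \<open>The map sending \<open>z\<close> to the vector with coordinates \<open>b z i\<close> is linear and injective, since
  \<open>b\<close> is definite; counting dimensions, it is onto. This is what gives existence in the definite
  description of the Christoffel term.\<close>
lemma inner_product_riesz:
  assumes b: "inner_product b" and f: "linear f"
  shows "\<exists>z. \<forall>u. b z u = f u"
proof -
  have bl: "bilinear b" and pos: "\<And>v. v \<noteq> 0 \<Longrightarrow> b v v > 0"
    using b by (auto simp: inner_product_def)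
  define T where "T z = (\<Sum>i\<in>Basis. b z i *\<^sub>R i)" for z
  have T: "T z \<bullet> i = b z i" if "i \<in> Basis" for z i
    using that by (simp add: T_def inner_sum_left inner_Basis if_distrib cong: if_cong)
  have "linear T"
    by (rule linearI)
       (auto simp: euclidean_eq_iff[where 'a='a] T bilinear_ladd[OF bl] bilinear_lmul[OF bl]
          inner_add_left)
  moreover have "z = 0" if "T z = 0" for z
  proof (rule ccontr)
    have "b z i = 0" if "i \<in> Basis" for i using T[OF that, of z] \<open>T z = 0\<close> by simp
    moreover have "b z z = (\<Sum>i\<in>Basis. (z \<bullet> i) * b z i)"
    proof -
      have lin: "linear (b z)" using bl by (simp add: bilinear_def)
      have "b z z = b z (\<Sum>i\<in>Basis. (z \<bullet> i) *\<^sub>R i)" by (simp add: euclidean_representation)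
      also have "\<dots> = (\<Sum>i\<in>Basis. (z \<bullet> i) * b z i)"
        by (simp only: linear_sum[OF lin] bilinear_rmul[OF bl] real_scaleR_def)
      finally show ?thesis .
    qed
    ultimately have "b z z = 0" by simp
    moreover assume "z \<noteq> 0"
    ultimately show False using pos[of z] by simp
  qed
  ultimately have "surj T"
    by (simp add: linear_injective_imp_surjective linear_injective_0)
  then obtain z where z: "T z = (\<Sum>i\<in>Basis. f i *\<^sub>R i)" by (metis surjD)
  have zi: "b z i = f i" if "i \<in> Basis" for i
    using T[OF that, of z] that by (simp add: z inner_sum_left inner_Basis if_distrib cong: if_cong)
  have "b z u = f u" for u
  proof -
    have lb: "linear (b z)" using bl by (simp add: bilinear_def)
    show ?thesis by (rule linear_eq_stdbasis[OF lb f, THEN fun_cong]) (rule zi)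
  qed
  then show ?thesis by blast
qed

lemma inner_product_cancel:
  assumes b: "inner_product b" and eq: "\<And>u. b z u = b z' u"
  shows "z = z'"
proof (rule ccontr)
  assume "z \<noteq> z'"
  then have "b (z - z') (z - z') > 0" using b by (simp add: inner_product_def)
  then show False using eq b by (simp add: inner_product_def bilinear_lsub)
qed

lemma normal_part_eqI:
  assumes b: "inner_product b" and T: "subspace T"
    and N: "X - N \<in> T" "\<And>Y. Y \<in> T \<Longrightarrow> b N Y = 0"
  shows "normal_part b T X = N"
  unfolding normal_part_def
proof (rule the_equality)
  fix N' assume N': "X - N' \<in> T \<and> (\<forall>Y\<in>T. b N' Y = 0)"
  have "(X - N) - (X - N') \<in> T" using N N' T by (blast intro: subspace_diff)
  then have d: "N' - N \<in> T" by simp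
  then have "b N' (N' - N) = 0" "b N (N' - N) = 0" using N N' by auto
  then have "b (N' - N) (N' - N) = 0"
    using b by (simp add: inner_product_def bilinear_lsub)
  then show "N' = N" using b by (metis inner_product_def eq_iff_diff_eq_0 less_irrefl)
qed (use N in auto)

lemma orthonormal_projection:
  assumes b: "inner_product b" and fin: "finite E"
    and on: "\<And>e e'. e \<in> E \<Longrightarrow> e' \<in> E \<Longrightarrow> b (f e) (f e') = (if e = e' then 1 else 0)"
    and e: "e \<in> E"
  shows "b (v - (\<Sum>e\<in>E. b v (f e) *\<^sub>R f e)) (f e) = 0"
proof -
  have bl: "bilinear b" using b by (simp add: inner_product_def)
  have lin: "linear (\<lambda>v. b v (f e))" using bl by (simp add: bilinear_def)
  have "b (\<Sum>e\<in>E. b v (f e) *\<^sub>R f e) (f e) = (\<Sum>e'\<in>E. b v (f e') * b (f e') (f e))"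
    by (simp add: linear_sum[OF lin] bilinear_lmul[OF bl])
  also have "\<dots> = (\<Sum>e'\<in>E. if e' = e then b v (f e) else 0)"
    by (rule sum.cong) (auto simp: on e)
  also have "\<dots> = b v (f e)" using fin e by simp
  finally show ?thesis by (simp add: bilinear_lsub[OF bl])
qed

text \<open>Bessel's inequality is stated for an indexed family because it will be applied to the images
  of an orthonormal frame under the differential of an immersion.\<close>
lemma inner_product_bessel:
  assumes b: "inner_product b" and fin: "finite E"
    and on: "\<And>e e'. e \<in> E \<Longrightarrow> e' \<in> E \<Longrightarrow> b (f e) (f e') = (if e = e' then 1 else 0)"
  shows "(\<Sum>e\<in>E. (b v (f e))\<^sup>2) \<le> b v v"
proof -
  have bl: "bilinear b" and sym: "\<And>v w. b v w = b w v"
    using b by (auto simp: inner_product_def)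
  define p where "p = (\<Sum>e\<in>E. b v (f e) *\<^sub>R f e)"
  have lin: "linear (b w)" for w using bl by (simp add: bilinear_def)
  have orth: "b (v - p) p = 0"
    unfolding p_def using orthonormal_projection[of b E f, OF b fin on]
    by (simp add: linear_sum[OF lin] bilinear_rmul[OF bl])
  have "b p v = (\<Sum>e\<in>E. (b v (f e))\<^sup>2)"
    using linear_sum[OF lin[of v], of "\<lambda>e. b v (f e) *\<^sub>R f e" E] sym
    by (simp add: p_def bilinear_rmul[OF bl] power2_eq_square)
  moreover have "0 \<le> b (v - p) (v - p)"
    using b by (metis inner_product_def less_imp_le bilinear_lzero order_refl)
  moreover have "b (v - p) (v - p) = b v v - b p v"
    using orth by (simp add: bilinear_rsub[OF bl] bilinear_lsub[OF bl])
  ultimately show ?thesis by simp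
qed

text \<open>Gram-Schmidt: while the family is smaller than the dimension, some vector lies outside its
  span, and removing its projection and normalising yields one more orthonormal vector. Without a
  basis the choice in \<^const>\<open>metric_trace\<close> would be meaningless.\<close>
lemma orthonormal_basis_exists:
  fixes b :: "'a::euclidean_space \<Rightarrow> 'a \<Rightarrow> real"
  assumes b: "inner_product b"
  shows "\<exists>E. orthonormal_basis b E"
proof -
  have bl: "bilinear b" using b by (simp add: inner_product_def)
  have "\<exists>E. finite E \<and> card E = k \<and> (\<forall>e\<in>E. \<forall>e'\<in>E. b e e' = (if e = e' then 1 else 0))"
    if "k \<le> DIM('a)" for k
    using that
  proof (induction k)
    case 0
    then show ?case by (intro exI[of _ "{}"]) auto
  next
    case (Suc k)
    then obtain E where E: "finite E" "card E = k"
      "\<And>e e'. e \<in> E \<Longrightarrow> e' \<in> E \<Longrightarrow> b e e' = (if e = e' then 1 else 0)" by auto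
    have "dim (span E) < DIM('a)"
      using dim_le_card[of "span E" E] E Suc.prems by auto
    then obtain w where w: "w \<notin> span E" by (metis UNIV_eq_I dim_UNIV less_irrefl)
    define v where "v = w - (\<Sum>e\<in>E. b w e *\<^sub>R e)"
    have ve: "b v e = 0" if "e \<in> E" for e
      using orthonormal_projection[of b E "\<lambda>e. e" e w] b E that by (simp add: v_def)
    have "(\<Sum>e\<in>E. b w e *\<^sub>R e) \<in> span E" by (intro span_sum span_scale span_base)
    then have "v \<noteq> 0" using w by (auto simp: v_def)
    then have vv: "b v v > 0" using b by (simp add: inner_product_def)
    define n where "n = (1 / sqrt (b v v)) *\<^sub>R v"
    have nn: "b n n = 1"
      using vv by (simp add: n_def bilinear_lmul[OF bl] bilinear_rmul[OF bl])
    have ne: "b n e = 0" if "e \<in> E" for e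
      using ve[OF that] by (simp add: n_def bilinear_lmul[OF bl])
    then have en: "b e n = 0" if "e \<in> E" for e
      using that b by (metis inner_product_def)
    have "n \<notin> E" using ne nn by force
    then show ?case
      using E nn ne en by (intro exI[of _ "insert n E"]) auto
  qed
  then show ?thesis unfolding orthonormal_basis_def by auto
qed

lemma orthonormal_basis_some:
  assumes "inner_product b"
  shows "orthonormal_basis b (SOME E. orthonormal_basis b E)"
  using orthonormal_basis_exists[OF assms] by (rule someI_ex)

section \<open>Symmetry of second derivatives\<close>

text \<open>The second difference of \<open>f\<close> over a parallelogram is symmetric in \<open>v\<close> and \<open>w\<close>. Two
  applications of the mean value theorem express it by one mixed second derivative at a point of
  the parallelogram; exchanging the roles of \<open>v\<close> and \<open>w\<close> gives the other mixed derivative.\<close>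
lemma second_difference_mean_value:
  fixes f :: "'a::euclidean_space \<Rightarrow> real"
  assumes P: "\<And>y. y \<in> S \<Longrightarrow> (f has_derivative P y) (at y)"
    and Q: "\<And>y. y \<in> S \<Longrightarrow> ((\<lambda>y. P y v) has_derivative Q y) (at y)"
    and s: "s > 0"
    and S: "\<And>a b. 0 \<le> a \<Longrightarrow> a \<le> s \<Longrightarrow> 0 \<le> b \<Longrightarrow> b \<le> s \<Longrightarrow> x + a *\<^sub>R v + b *\<^sub>R w \<in> S"
  shows "\<exists>a b. 0 \<le> a \<and> a \<le> s \<and> 0 \<le> b \<and> b \<le> s \<and>
    f (x + s *\<^sub>R v + s *\<^sub>R w) - f (x + s *\<^sub>R v) - f (x + s *\<^sub>R w) + f x
      = s\<^sup>2 * Q (x + a *\<^sub>R v + b *\<^sub>R w) w"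
proof -
  have S0: "x + a *\<^sub>R v \<in> S" if "0 \<le> a" "a \<le> s" for a using S[OF that, of 0] s by simp
  have lin: "linear (P y)" "linear (Q y)" if "y \<in> S" for y
    using P[OF that] Q[OF that] has_derivative_linear by auto
  define g where "g a = f (x + a *\<^sub>R v + s *\<^sub>R w) - f (x + a *\<^sub>R v)" for a
  have "(g has_real_derivative P (x + a *\<^sub>R v + s *\<^sub>R w) v - P (x + a *\<^sub>R v) v) (at a)"
    if a: "0 \<le> a" "a \<le> s" for a
  proof -
    have in1: "x + a *\<^sub>R v + s *\<^sub>R w \<in> S" using a s by (intro S) auto
    have in2: "x + a *\<^sub>R v \<in> S" using a by (intro S0) auto
    have l1: "((\<lambda>a. x + a *\<^sub>R v + s *\<^sub>R w) has_derivative (\<lambda>t. t *\<^sub>R v)) (at a)"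
      by (auto intro!: derivative_eq_intros)
    have l2: "((\<lambda>a. x + a *\<^sub>R v) has_derivative (\<lambda>t. t *\<^sub>R v)) (at a)"
      by (auto intro!: derivative_eq_intros)
    have 1: "((\<lambda>a. f (x + a *\<^sub>R v + s *\<^sub>R w)) has_derivative
        (\<lambda>t. P (x + a *\<^sub>R v + s *\<^sub>R w) (t *\<^sub>R v))) (at a)"
      by (rule has_derivative_compose[OF l1 P[OF in1]])
    have 2: "((\<lambda>a. f (x + a *\<^sub>R v)) has_derivative (\<lambda>t. P (x + a *\<^sub>R v) (t *\<^sub>R v))) (at a)"
      by (rule has_derivative_compose[OF l2 P[OF in2]])
    show ?thesis
      unfolding g_def has_field_derivative_def
      by (rule has_derivative_eq_rhs[OF has_derivative_diff[OF 1 2]])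
         (simp add: fun_eq_iff linear_cmul[OF lin(1)[OF in1]] linear_cmul[OF lin(1)[OF in2]]
           mult.commute right_diff_distrib)
  qed
  then obtain a where a: "0 < a" "a < s"
      "g s - g 0 = (s - 0) * (P (x + a *\<^sub>R v + s *\<^sub>R w) v - P (x + a *\<^sub>R v) v)"
    using MVT2[of 0 s g "\<lambda>a. P (x + a *\<^sub>R v + s *\<^sub>R w) v - P (x + a *\<^sub>R v) v"] s by auto
  define k where "k b = P (x + a *\<^sub>R v + b *\<^sub>R w) v" for b
  have "(k has_real_derivative Q (x + a *\<^sub>R v + b *\<^sub>R w) w) (at b)" if b: "0 \<le> b" "b \<le> s" for b
  proof -
    have in1: "x + a *\<^sub>R v + b *\<^sub>R w \<in> S" using a b by (intro S) auto
    have l1: "((\<lambda>b. x + a *\<^sub>R v + b *\<^sub>R w) has_derivative (\<lambda>t. t *\<^sub>R w)) (at b)"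
      by (auto intro!: derivative_eq_intros)
    have 1: "(k has_derivative (\<lambda>t. Q (x + a *\<^sub>R v + b *\<^sub>R w) (t *\<^sub>R w))) (at b)"
      unfolding k_def by (rule has_derivative_compose[OF l1 Q[OF in1]])
    show ?thesis
      unfolding has_field_derivative_def
      by (rule has_derivative_eq_rhs[OF 1])
         (simp add: fun_eq_iff linear_cmul[OF lin(2)[OF in1]])
  qed
  then obtain b where b: "0 < b" "b < s" "k s - k 0 = (s - 0) * Q (x + a *\<^sub>R v + b *\<^sub>R w) w"
    using MVT2[of 0 s k "\<lambda>b. Q (x + a *\<^sub>R v + b *\<^sub>R w) w"] s by auto
  have "f (x + s *\<^sub>R v + s *\<^sub>R w) - f (x + s *\<^sub>R v) - f (x + s *\<^sub>R w) + f x = g s - g 0"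
    by (simp add: g_def)
  also have "\<dots> = s * (k s - k 0)" using a by (simp add: k_def)
  also have "\<dots> = s\<^sup>2 * Q (x + a *\<^sub>R v + b *\<^sub>R w) w" using b by (simp add: power2_eq_square)
  finally show ?thesis using a b by (intro exI[of _ a] exI[of _ b]) simp
qed

text \<open>Shrink the parallelogram: both mixed derivatives take the same value at points of it, possibly
  different ones, so by continuity they agree at \<open>x\<close>.\<close>
lemma schwarz_real:
  fixes f :: "'a::euclidean_space \<Rightarrow> real"
  assumes "open S" "x \<in> S"
    and P: "\<And>y. y \<in> S \<Longrightarrow> (f has_derivative P y) (at y)"
    and Q: "\<And>y v. y \<in> S \<Longrightarrow> ((\<lambda>y. P y v) has_derivative (\<lambda>w. Q y w v)) (at y)"
    and cont: "\<And>v w. continuous_on S (\<lambda>y. Q y w v)"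
  shows "Q x v w = Q x w v"
proof (rule ccontr)
  assume ne: "Q x v w \<noteq> Q x w v"
  \<comment> \<open>With half the gap as tolerance, values near the two sides cannot coincide.\<close>
  define e where "e = \<bar>Q x v w - Q x w v\<bar> / 2"
  have e: "e > 0" using ne by (simp add: e_def)
  have near: "\<exists>d>0. \<forall>y. dist y x < d \<longrightarrow> y \<in> S \<and> \<bar>Q y w v - Q x w v\<bar> < e" for v w
  proof -
    have "isCont (\<lambda>y. Q y w v) x"
      using cont assms(1,2) continuous_on_eq_continuous_at by blast
    then obtain d1 where d1: "d1 > 0" "\<And>y. dist y x < d1 \<Longrightarrow> dist (Q y w v) (Q x w v) < e"
      using e by (auto simp: continuous_at_eps_delta)
    obtain d2 where "d2 > 0" "\<And>y. dist y x < d2 \<Longrightarrow> y \<in> S"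
      using assms(1,2) by (auto simp: open_dist)
    with d1 show ?thesis by (intro exI[of _ "min d1 d2"]) (auto simp: dist_real_def)
  qed
  obtain d1 where d1: "d1 > 0" "\<And>y. dist y x < d1 \<Longrightarrow> y \<in> S \<and> \<bar>Q y w v - Q x w v\<bar> < e"
    using near by blast
  obtain d2 where d2: "d2 > 0" "\<And>y. dist y x < d2 \<Longrightarrow> y \<in> S \<and> \<bar>Q y v w - Q x v w\<bar> < e"
    using near by blast
  define d where "d = min d1 d2"
  define s where "s = d / (2 * (norm v + norm w + 1))"
  have d: "d > 0" using d1 d2 by (simp add: d_def)
  have pos: "norm v + norm w + 1 > 0" by (simp add: add_nonneg_pos)
  then have s: "s > 0" using d by (simp add: s_def)
  have small: "dist (x + a *\<^sub>R v + b *\<^sub>R w) x < d" if "0 \<le> a" "a \<le> s" "0 \<le> b" "b \<le> s" for a b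
  proof -
    have "dist (x + a *\<^sub>R v + b *\<^sub>R w) x = norm (a *\<^sub>R v + b *\<^sub>R w)" by (simp add: dist_norm)
    also have "\<dots> \<le> a * norm v + b * norm w"
      using norm_triangle_ineq[of "a *\<^sub>R v" "b *\<^sub>R w"] that by simp
    also have "\<dots> \<le> s * norm v + s * norm w"
      using that by (intro add_mono mult_right_mono) auto
    also have "\<dots> \<le> s * (norm v + norm w + 1)" using s by (simp add: algebra_simps)
    also have "\<dots> = d / 2" using pos by (simp add: s_def field_simps)
    also have "\<dots> < d" using d by simp
    finally show ?thesis .
  qed
  have small': "dist (x + a *\<^sub>R w + b *\<^sub>R v) x < d" if "0 \<le> a" "a \<le> s" "0 \<le> b" "b \<le> s" for a b
    using small[of b a] that by (simp add: ac_simps)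
  have inS: "y \<in> S" if "dist y x < d" for y using d1 that by (simp add: d_def)
  obtain a b where ab: "0 \<le> a" "a \<le> s" "0 \<le> b" "b \<le> s"
    "f (x + s *\<^sub>R v + s *\<^sub>R w) - f (x + s *\<^sub>R v) - f (x + s *\<^sub>R w) + f x
      = s\<^sup>2 * Q (x + a *\<^sub>R v + b *\<^sub>R w) w v"
    using second_difference_mean_value[of S f P v "\<lambda>y w. Q y w v" s x w, OF P Q s inS[OF small]]
    by blast
  obtain a' b' where ab': "0 \<le> a'" "a' \<le> s" "0 \<le> b'" "b' \<le> s"
    "f (x + s *\<^sub>R w + s *\<^sub>R v) - f (x + s *\<^sub>R w) - f (x + s *\<^sub>R v) + f x
      = s\<^sup>2 * Q (x + a' *\<^sub>R w + b' *\<^sub>R v) v w"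
    using second_difference_mean_value[of S f P w "\<lambda>y v. Q y v w" s x v, OF P Q s inS[OF small']]
    by blast
  have "s\<^sup>2 * Q (x + a *\<^sub>R v + b *\<^sub>R w) w v = s\<^sup>2 * Q (x + a' *\<^sub>R w + b' *\<^sub>R v) v w"
    unfolding ab(5)[symmetric] ab'(5)[symmetric] by (simp add: algebra_simps)
  then have "Q (x + a *\<^sub>R v + b *\<^sub>R w) w v = Q (x + a' *\<^sub>R w + b' *\<^sub>R v) v w"
    using s by (metis mult_cancel_left power_not_zero less_irrefl)
  moreover have "\<bar>Q (x + a *\<^sub>R v + b *\<^sub>R w) w v - Q x w v\<bar> < e"
    using d1(2) small[OF ab(1-4)] by (simp add: d_def)
  moreover have "\<bar>Q (x + a' *\<^sub>R w + b' *\<^sub>R v) v w - Q x v w\<bar> < e"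
    using d2(2) small'[OF ab'(1-4)] by (simp add: d_def)
  ultimately show False using e by (simp add: e_def abs_if split: if_splits)
qed

section \<open>Riemannian metrics and the Koszul formula\<close>

definition metric_on :: "'b::euclidean_space set \<Rightarrow> 'b metric \<Rightarrow> bool" where
  "metric_on W h \<longleftrightarrow> (\<forall>z\<in>W. inner_product (h z) \<and> (\<forall>a b. (\<lambda>y. h y a b) differentiable (at z)))"

lemma metric_on_has_derivative:
  assumes "metric_on W h" "z \<in> W"
  shows "((\<lambda>y. h y a b) has_derivative frechet_derivative (\<lambda>y. h y a b) (at z)) (at z)"
  using assms by (simp add: metric_on_def frechet_derivative_works[THEN iffD1])

text \<open>The Leibniz rule for \<open>h(X, Y)\<close> with fields \<open>X\<close>, \<open>Y\<close> along \<open>\<psi>\<close>. Since \<open>h\<close> is only known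
  to be differentiable for fixed arguments, the product is first written as a finite sum over
  pairs of basis vectors.\<close>
lemma has_derivative_metric_along:
  fixes h :: "'b::euclidean_space metric" and \<psi> :: "'a::euclidean_space \<Rightarrow> 'b"
  assumes h: "metric_on W h" and W: "open W" "\<psi> x \<in> W"
    and \<psi>: "(\<psi> has_derivative \<psi>') (at x)"
    and X: "(X has_derivative X') (at x)" and Y: "(Y has_derivative Y') (at x)"
  shows "((\<lambda>y. h (\<psi> y) (X y) (Y y)) has_derivative
    (\<lambda>v. frechet_derivative (\<lambda>z. h z (X x) (Y x)) (at (\<psi> x)) (\<psi>' v)
        + h (\<psi> x) (X' v) (Y x) + h (\<psi> x) (X x) (Y' v))) (at x)"
proof -
  define D where "D i j = frechet_derivative (\<lambda>z. h z i j) (at (\<psi> x))" for i j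
  have D: "((\<lambda>z. h z i j) has_derivative D i j) (at (\<psi> x))" for i j
    unfolding D_def by (rule metric_on_has_derivative[OF h W(2)])
  have bl: "bilinear (h z)" if "z \<in> W" for z
    using h that by (simp add: metric_on_def inner_product_def)
  have expand: "h z a b = (\<Sum>i\<in>Basis. \<Sum>j\<in>Basis. (a \<bullet> i) * (b \<bullet> j) * h z i j)" if "z \<in> W" for z a b
    by (rule bilinear_expand[OF bl[OF that]])
  have D_expand: "D a b c = (\<Sum>i\<in>Basis. \<Sum>j\<in>Basis. (a \<bullet> i) * (b \<bullet> j) * D i j c)" for a b c
  proof -
    have "((\<lambda>z. \<Sum>i\<in>Basis. \<Sum>j\<in>Basis. (a \<bullet> i) * (b \<bullet> j) * h z i j) has_derivative
        (\<lambda>c. \<Sum>i\<in>Basis. \<Sum>j\<in>Basis. (a \<bullet> i) * (b \<bullet> j) * D i j c)) (at (\<psi> x))"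
      by (intro has_derivative_sum has_derivative_mult_right D)
    then have "((\<lambda>z. h z a b) has_derivative
        (\<lambda>c. \<Sum>i\<in>Basis. \<Sum>j\<in>Basis. (a \<bullet> i) * (b \<bullet> j) * D i j c)) (at (\<psi> x))"
      by (rule has_derivative_transform_within_open[OF _ W]) (rule expand[symmetric])
    from has_derivative_unique[OF D this] show ?thesis by simp
  qed
  have H: "((\<lambda>y. h (\<psi> y) i j) has_derivative (\<lambda>v. D i j (\<psi>' v))) (at x)" for i j
    using has_derivative_compose[OF \<psi> D] .
  have prod: "((\<lambda>y. (X y \<bullet> i) * (Y y \<bullet> j) * h (\<psi> y) i j) has_derivative
      (\<lambda>v. (X x \<bullet> i) * (Y x \<bullet> j) * D i j (\<psi>' v) + (X' v \<bullet> i) * (Y x \<bullet> j) * h (\<psi> x) i j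
         + (X x \<bullet> i) * (Y' v \<bullet> j) * h (\<psi> x) i j)) (at x)" for i j
    by (rule has_derivative_eq_rhs, rule has_derivative_mult[OF has_derivative_mult[OF
          has_derivative_inner_left[OF X] has_derivative_inner_left[OF Y]] H])
       (simp add: fun_eq_iff algebra_simps)
  have sums: "((\<lambda>y. \<Sum>i\<in>Basis. \<Sum>j\<in>Basis. (X y \<bullet> i) * (Y y \<bullet> j) * h (\<psi> y) i j) has_derivative
    (\<lambda>v. D (X x) (Y x) (\<psi>' v) + h (\<psi> x) (X' v) (Y x) + h (\<psi> x) (X x) (Y' v))) (at x)"
    by (rule has_derivative_eq_rhs[OF has_derivative_sum[OF has_derivative_sum[OF prod]]])
       (simp add: D_expand[of "X x" "Y x"] expand[OF W(2), of "X' _" "Y x"]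
          expand[OF W(2), of "X x" "Y' _"] sum.distrib)
  have "\<forall>\<^sub>F y in at x. \<psi> y \<in> W"
    using has_derivative_continuous[OF \<psi>] W by (auto simp: continuous_within intro: topological_tendstoD)
  then have "\<forall>\<^sub>F y in at x. (\<Sum>i\<in>Basis. \<Sum>j\<in>Basis. (X y \<bullet> i) * (Y y \<bullet> j) * h (\<psi> y) i j)
      = h (\<psi> y) (X y) (Y y)"
    by eventually_elim (rule expand[symmetric])
  with sums have "((\<lambda>y. h (\<psi> y) (X y) (Y y)) has_derivative
    (\<lambda>v. D (X x) (Y x) (\<psi>' v) + h (\<psi> x) (X' v) (Y x) + h (\<psi> x) (X x) (Y' v))) (at x)"
    by (rule has_derivative_transform_eventually) (simp_all add: expand[OF W(2), symmetric])
  then show ?thesis by (simp add: D_def)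
qed

lemma metric_derivative_linear_right:
  fixes h :: "'b::euclidean_space metric"
  assumes h: "metric_on W h" and W: "open W" "z \<in> W"
  shows "linear (\<lambda>b. frechet_derivative (\<lambda>y. h y a b) (at z) c)"
proof -
  have bl: "bilinear (h y)" if "y \<in> W" for y
    using h that by (auto simp: metric_on_def inner_product_def)
  note D = metric_on_has_derivative[OF h W(2)]
  show "linear (\<lambda>b. frechet_derivative (\<lambda>y. h y a b) (at z) c)"
  proof (rule linearI)
    fix b b'
    have "((\<lambda>y. h y a (b + b')) has_derivative (\<lambda>c. frechet_derivative (\<lambda>y. h y a b) (at z) c
        + frechet_derivative (\<lambda>y. h y a b') (at z) c)) (at z)"
      by (rule has_derivative_transform_within_open[OF has_derivative_add[OF D[of a b] D[of a b']] W])
         (simp add: bilinear_radd[OF bl])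
    from has_derivative_unique[OF D this]
    show "frechet_derivative (\<lambda>y. h y a (b + b')) (at z) c =
      frechet_derivative (\<lambda>y. h y a b) (at z) c + frechet_derivative (\<lambda>y. h y a b') (at z) c" by simp
  next
    fix r b
    have "((\<lambda>y. h y a (r *\<^sub>R b)) has_derivative
        (\<lambda>c. r * frechet_derivative (\<lambda>y. h y a b) (at z) c)) (at z)"
      by (rule has_derivative_transform_within_open[OF has_derivative_mult_right[OF D[of a b]] W])
         (simp add: bilinear_rmul[OF bl])
    from has_derivative_unique[OF D this]
    show "frechet_derivative (\<lambda>y. h y a (r *\<^sub>R b)) (at z) c =
      r *\<^sub>R frechet_derivative (\<lambda>y. h y a b) (at z) c" by simp
  qed
qed

text \<open>The right-hand side is linear in \<open>u\<close>, so the Riesz representation provides a vector with this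
  property, and definiteness makes it unique; hence the definite description is proper.\<close>
lemma koszul:
  fixes h :: "'b::euclidean_space metric"
  assumes h: "metric_on W h" and W: "open W" "z \<in> W"
  shows "2 * h z (christoffel h z v w) u = frechet_derivative (\<lambda>y. h y w u) (at z) v
     + frechet_derivative (\<lambda>y. h y v u) (at z) w - frechet_derivative (\<lambda>y. h y v w) (at z) u"
proof -
  define K where "K u = frechet_derivative (\<lambda>y. h y w u) (at z) v
     + frechet_derivative (\<lambda>y. h y v u) (at z) w - frechet_derivative (\<lambda>y. h y v w) (at z) u" for u
  have ip: "inner_product (h z)" using h W by (simp add: metric_on_def)
  have "linear K"
    unfolding K_def
    by (intro linear_compose_sub linear_compose_add metric_derivative_linear_right[OF h W]
        has_derivative_linear[OF metric_on_has_derivative[OF h W(2)]])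
  then have "linear (\<lambda>u. (1/2) *\<^sub>R K u)" by (rule linear_compose_scale_right)
  then obtain \<Gamma> where "\<forall>u. h z \<Gamma> u = (1/2) *\<^sub>R K u"
    using inner_product_riesz[OF ip] by blast
  then have \<Gamma>: "\<forall>u. 2 * h z \<Gamma> u = K u" by (simp add: mult.commute)
  have "christoffel h z v w = \<Gamma>"
    unfolding christoffel_def K_def[symmetric]
  proof (rule the_equality)
    fix \<Gamma>' assume "\<forall>u. 2 * h z \<Gamma>' u = K u"
    then have "h z \<Gamma>' u = h z \<Gamma> u" for u using \<Gamma> by (metis mult_cancel_left zero_neq_numeral)
    then show "\<Gamma>' = \<Gamma>" by (rule inner_product_cancel[OF ip])
  qed (rule \<Gamma>)
  then show ?thesis using \<Gamma> by (simp add: K_def)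
qed

section \<open>Twice continuously differentiable maps\<close>

lemma C2_on_derivatives:
  assumes "Ck_on 2 S f"
  shows "\<And>x. x \<in> S \<Longrightarrow> (f has_derivative frechet_derivative f (at x)) (at x)"
    and "\<And>x w. x \<in> S \<Longrightarrow> ((\<lambda>y. frechet_derivative f (at y) w) has_derivative
        (\<lambda>v. second_derivative f x v w)) (at x)"
    and "\<And>v w. continuous_on S (\<lambda>y. second_derivative f y v w)"
  using assms
  by (auto simp: numeral_2_eq_2 second_derivative_def frechet_derivative_works[THEN iffD1])

text \<open>Explicit candidates for the first two derivatives, given on an open set, both establish the
  regularity and determine the values of the derivatives.\<close>
lemma C2_onI:
  assumes S: "open S"
    and D: "\<And>x. x \<in> S \<Longrightarrow> (f has_derivative D x) (at x)"
    and D2: "\<And>x w. x \<in> S \<Longrightarrow> ((\<lambda>y. D y w) has_derivative (\<lambda>v. D2 x v w)) (at x)"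
    and cont: "\<And>v w. continuous_on S (\<lambda>y. D2 y v w)"
  shows "Ck_on 2 S f"
    and "\<And>x. x \<in> S \<Longrightarrow> frechet_derivative f (at x) = D x"
    and "\<And>x v w. x \<in> S \<Longrightarrow> second_derivative f x v w = D2 x v w"
proof -
  have f: "frechet_derivative f (at x) = D x" if "x \<in> S" for x
    using frechet_derivative_at[OF D[OF that]] by simp
  have f2: "((\<lambda>y. frechet_derivative f (at y) w) has_derivative (\<lambda>v. D2 x v w)) (at x)"
    if "x \<in> S" for x w
    by (rule has_derivative_transform_within_open[OF D2[OF that] S that]) (simp add: f)
  have f2': "frechet_derivative (\<lambda>y. frechet_derivative f (at y) w) (at x) = (\<lambda>v. D2 x v w)"
    if "x \<in> S" for x w
    using frechet_derivative_at[OF f2[OF that]] by simp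
  show "second_derivative f x v w = D2 x v w" if "x \<in> S" for x v w
    using f2'[OF that] by (simp add: second_derivative_def)
  show "frechet_derivative f (at x) = D x" if "x \<in> S" for x by (rule f[OF that])
  show "Ck_on 2 S f"
    unfolding numeral_2_eq_2 Ck_on.simps
    using D f2 cont by (auto simp: differentiable_def f2' cong: continuous_on_cong)
qed

lemma second_derivative_sym:
  fixes f :: "'a::euclidean_space \<Rightarrow> 'b::euclidean_space"
  assumes S: "open S" "x \<in> S" and f: "Ck_on 2 S f"
  shows "second_derivative f x v w = second_derivative f x w v"
proof (rule euclidean_eqI)
  fix i :: 'b assume "i \<in> Basis"
  note d = C2_on_derivatives[OF f]
  show "second_derivative f x v w \<bullet> i = second_derivative f x w v \<bullet> i"
    by (rule schwarz_real[OF S, where f="\<lambda>x. f x \<bullet> i" and P="\<lambda>x v. frechet_derivative f (at x) v \<bullet> i"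
          and Q="\<lambda>x v w. second_derivative f x v w \<bullet> i"])
       (auto intro!: has_derivative_inner_left d continuous_intros)
qed

lemma linear_functional_expand:
  fixes D :: "'b::euclidean_space \<Rightarrow> real"
  assumes "linear D"
  shows "D v = (\<Sum>i\<in>Basis. (v \<bullet> i) * D i)"
proof -
  have "D v = D (\<Sum>i\<in>Basis. (v \<bullet> i) *\<^sub>R i)" by (simp add: euclidean_representation)
  also have "\<dots> = (\<Sum>i\<in>Basis. (v \<bullet> i) * D i)"
    by (simp only: linear_sum[OF assms] linear_cmul[OF assms] real_scaleR_def)
  finally show ?thesis .
qed

text \<open>The second-order chain rule. As for metrics, the first derivative of \<open>G\<close> is only
  differentiable for a fixed direction, so the moving direction \<open>D\<psi> w\<close> is expanded in the standard
  basis.\<close>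
lemma C2_on_compose:
  fixes \<psi> :: "'a::euclidean_space \<Rightarrow> 'b::euclidean_space" and G :: "'b \<Rightarrow> real"
  assumes S: "open S" and W: "open W" and im: "\<psi> ` S \<subseteq> W"
    and \<psi>: "Ck_on 2 S \<psi>" and G: "Ck_on 2 W G"
  shows "Ck_on 2 S (G \<circ> \<psi>)"
    and "\<And>x. x \<in> S \<Longrightarrow> frechet_derivative (G \<circ> \<psi>) (at x) =
        (\<lambda>v. frechet_derivative G (at (\<psi> x)) (frechet_derivative \<psi> (at x) v))"
    and "\<And>x v w. x \<in> S \<Longrightarrow> second_derivative (G \<circ> \<psi>) x v w =
        second_derivative G (\<psi> x) (frechet_derivative \<psi> (at x) v) (frechet_derivative \<psi> (at x) w)
      + frechet_derivative G (at (\<psi> x)) (second_derivative \<psi> x v w)"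
proof -
  note d\<psi> = C2_on_derivatives[OF \<psi>] and dG = C2_on_derivatives[OF G]
  define P where "P x = frechet_derivative \<psi> (at x)" for x
  define Q where "Q x v w = second_derivative \<psi> x v w" for x v w
  define DG where "DG z = frechet_derivative G (at z)" for z
  define D2G where "D2G z v w = second_derivative G z v w" for z v w
  note defs = P_def Q_def DG_def D2G_def
  have W': "\<psi> x \<in> W" if "x \<in> S" for x using im that by auto
  have linG: "linear (DG z)" if "z \<in> W" for z
    using has_derivative_linear[OF dG(1)[OF that]] by (simp add: DG_def)
  have DG_expand: "DG z a = (\<Sum>i\<in>Basis. (a \<bullet> i) * DG z i)" if "z \<in> W" for z a
    by (rule linear_functional_expand[OF linG[OF that]])
  have D2G_expand: "D2G z c a = (\<Sum>i\<in>Basis. (a \<bullet> i) * D2G z c i)" if z: "z \<in> W" for z a c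
  proof -
    have "((\<lambda>z. \<Sum>i\<in>Basis. (a \<bullet> i) * DG z i) has_derivative
        (\<lambda>c. \<Sum>i\<in>Basis. (a \<bullet> i) * D2G z c i)) (at z)"
      unfolding defs by (intro has_derivative_sum has_derivative_mult_right dG(2)[OF z])
    then have "((\<lambda>z. DG z a) has_derivative (\<lambda>c. \<Sum>i\<in>Basis. (a \<bullet> i) * D2G z c i)) (at z)"
      by (rule has_derivative_transform_within_open[OF _ W z]) (rule DG_expand[symmetric])
    moreover have "((\<lambda>z. DG z a) has_derivative (\<lambda>c. D2G z c a)) (at z)"
      unfolding defs by (rule dG(2)[OF z])
    ultimately show ?thesis by (metis has_derivative_unique)
  qed
  have D2G_linear: "linear (\<lambda>c. D2G z c a)" if "z \<in> W" for z a
    unfolding defs by (rule has_derivative_linear[OF dG(2)[OF that]])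
  have D: "(G \<circ> \<psi> has_derivative (\<lambda>v. DG (\<psi> x) (P x v))) (at x)" if "x \<in> S" for x
    unfolding o_def defs by (rule has_derivative_compose[OF d\<psi>(1)[OF that] dG(1)[OF W'[OF that]]])
  have D2: "((\<lambda>y. DG (\<psi> y) (P y w)) has_derivative
      (\<lambda>v. D2G (\<psi> x) (P x v) (P x w) + DG (\<psi> x) (Q x v w))) (at x)" if x: "x \<in> S" for x w
  proof -
    have X: "((\<lambda>y. P y w) has_derivative (\<lambda>v. Q x v w)) (at x)"
      unfolding defs by (rule d\<psi>(2)[OF x])
    have Y: "((\<lambda>y. DG (\<psi> y) i) has_derivative (\<lambda>v. D2G (\<psi> x) (P x v) i)) (at x)" for i
      unfolding defs by (rule has_derivative_compose[OF d\<psi>(1)[OF x] dG(2)[OF W'[OF x]]])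
    have "((\<lambda>y. \<Sum>i\<in>Basis. (P y w \<bullet> i) * DG (\<psi> y) i) has_derivative
      (\<lambda>v. D2G (\<psi> x) (P x v) (P x w) + DG (\<psi> x) (Q x v w))) (at x)"
      by (rule has_derivative_eq_rhs[OF has_derivative_sum[OF
            has_derivative_mult[OF has_derivative_inner_left[OF X] Y]]])
         (simp add: D2G_expand[OF W'[OF x], of _ "P x w"] DG_expand[OF W'[OF x], of "Q x _ w"]
            sum.distrib)
    then show ?thesis
      by (rule has_derivative_transform_within_open[OF _ S x]) (rule DG_expand[OF W', symmetric])
  qed
  have cont_P: "continuous_on S (\<lambda>x. P x v)" for v
    unfolding defs using d\<psi>(2) by (intro has_derivative_continuous_on[where f'="\<lambda>x w. second_derivative \<psi> x w v"])
      (auto intro: has_derivative_at_withinI)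
  have cont_\<psi>: "continuous_on S \<psi>"
    using d\<psi>(1) by (intro has_derivative_continuous_on[where f'="\<lambda>x. frechet_derivative \<psi> (at x)"])
      (auto intro: has_derivative_at_withinI)
  have cont_DG: "continuous_on W (\<lambda>x. DG x v)" for v
    unfolding defs using dG(2) by (intro has_derivative_continuous_on[where f'="\<lambda>x w. second_derivative G x w v"])
      (auto intro: has_derivative_at_withinI)
  have cont_D2G: "continuous_on W (\<lambda>x. D2G x v w)" for v w
    unfolding defs by (rule dG(3))
  have cont_Q: "continuous_on S (\<lambda>x. Q x v w)" for v w
    unfolding defs by (rule d\<psi>(3))
  have cont: "continuous_on S (\<lambda>x. D2G (\<psi> x) (P x v) (P x w) + DG (\<psi> x) (Q x v w))" for v w
  proof -
    have "D2G (\<psi> x) (P x v) i = (\<Sum>j\<in>Basis. (P x v \<bullet> j) * D2G (\<psi> x) j i)"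
      if "x \<in> S" for x i
      by (rule linear_functional_expand[OF D2G_linear[OF W'[OF that]]])
    then have "D2G (\<psi> x) (P x v) (P x w) = (\<Sum>i\<in>Basis. (P x w \<bullet> i) * (\<Sum>j\<in>Basis. (P x v \<bullet> j) * D2G (\<psi> x) j i))"
      if "x \<in> S" for x
      using D2G_expand[OF W'[OF that], of "P x v" "P x w"] that by simp
    moreover have "DG (\<psi> x) (Q x v w) = (\<Sum>i\<in>Basis. (Q x v w \<bullet> i) * DG (\<psi> x) i)" if "x \<in> S" for x
      by (rule DG_expand[OF W'[OF that]])
    moreover have "continuous_on S (\<lambda>x. (\<Sum>i\<in>Basis. (P x w \<bullet> i) *
        (\<Sum>j\<in>Basis. (P x v \<bullet> j) * D2G (\<psi> x) j i)) + (\<Sum>i\<in>Basis. (Q x v w \<bullet> i) * DG (\<psi> x) i))"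
      by (intro continuous_intros cont_P cont_Q continuous_on_compose2[OF cont_D2G cont_\<psi> im]
          continuous_on_compose2[OF cont_DG cont_\<psi> im])
    ultimately show ?thesis by (simp cong: continuous_on_cong)
  qed
  note * = C2_onI[OF S D D2 cont]
  show "Ck_on 2 S (G \<circ> \<psi>)" by (rule *(1))
  show "frechet_derivative (G \<circ> \<psi>) (at x) =
        (\<lambda>v. frechet_derivative G (at (\<psi> x)) (frechet_derivative \<psi> (at x) v))" if "x \<in> S" for x
    using *(2)[OF _ _ that] by (simp add: defs)
  show "second_derivative (G \<circ> \<psi>) x v w =
        second_derivative G (\<psi> x) (frechet_derivative \<psi> (at x) v) (frechet_derivative \<psi> (at x) w)
      + frechet_derivative G (at (\<psi> x)) (second_derivative \<psi> x v w)" if "x \<in> S" for x v w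
    using *(3)[OF _ _ that] by (simp add: defs)
qed

section \<open>The Gauss formula\<close>

lemma pullback_inner_product:
  assumes h: "inner_product (h (\<psi> x))" and \<psi>: "linear (frechet_derivative \<psi> (at x))"
    and inj: "inj (frechet_derivative \<psi> (at x))"
  shows "inner_product (pullback_metric h \<psi> x)"
proof -
  have "frechet_derivative \<psi> (at x) v \<noteq> 0" if "v \<noteq> 0" for v
    using that \<psi> inj by (metis linear_injective_0)
  then show ?thesis
    using h \<psi> unfolding inner_product_def pullback_metric_def bilinear_def
    by (auto simp: linear_iff)
qed

lemma
  fixes h :: "'b::euclidean_space metric" and \<psi> :: "'a::euclidean_space \<Rightarrow> 'b"
  assumes S: "open S" and W: "open W" and im: "\<psi> ` S \<subseteq> W"
    and h: "metric_on W h" and \<psi>: "Ck_on 2 S \<psi>"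
  shows pullback_metric_has_derivative: "x \<in> S \<Longrightarrow>
      ((\<lambda>y. pullback_metric h \<psi> y v w) has_derivative (\<lambda>u.
        frechet_derivative (\<lambda>z. h z (frechet_derivative \<psi> (at x) v) (frechet_derivative \<psi> (at x) w))
          (at (\<psi> x)) (frechet_derivative \<psi> (at x) u)
        + h (\<psi> x) (second_derivative \<psi> x u v) (frechet_derivative \<psi> (at x) w)
        + h (\<psi> x) (frechet_derivative \<psi> (at x) v) (second_derivative \<psi> x u w))) (at x)"
    and metric_on_pullback: "(\<And>x. x \<in> S \<Longrightarrow> inj (frechet_derivative \<psi> (at x))) \<Longrightarrow>
      metric_on S (pullback_metric h \<psi>)"
proof -
  note d\<psi> = C2_on_derivatives[OF \<psi>]
  have der: "((\<lambda>y. pullback_metric h \<psi> y v w) has_derivative (\<lambda>u.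
        frechet_derivative (\<lambda>z. h z (frechet_derivative \<psi> (at x) v) (frechet_derivative \<psi> (at x) w))
          (at (\<psi> x)) (frechet_derivative \<psi> (at x) u)
        + h (\<psi> x) (second_derivative \<psi> x u v) (frechet_derivative \<psi> (at x) w)
        + h (\<psi> x) (frechet_derivative \<psi> (at x) v) (second_derivative \<psi> x u w))) (at x)"
    if x: "x \<in> S" for x v w
    unfolding pullback_metric_def
    by (rule has_derivative_metric_along[OF h W _ d\<psi>(1)[OF x] d\<psi>(2)[OF x] d\<psi>(2)[OF x]])
       (use im x in auto)
  then show "x \<in> S \<Longrightarrow>
      ((\<lambda>y. pullback_metric h \<psi> y v w) has_derivative (\<lambda>u.
        frechet_derivative (\<lambda>z. h z (frechet_derivative \<psi> (at x) v) (frechet_derivative \<psi> (at x) w))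
          (at (\<psi> x)) (frechet_derivative \<psi> (at x) u)
        + h (\<psi> x) (second_derivative \<psi> x u v) (frechet_derivative \<psi> (at x) w)
        + h (\<psi> x) (frechet_derivative \<psi> (at x) v) (second_derivative \<psi> x u w))) (at x)" .
  assume inj: "\<And>x. x \<in> S \<Longrightarrow> inj (frechet_derivative \<psi> (at x))"
  show "metric_on S (pullback_metric h \<psi>)"
    unfolding metric_on_def differentiable_def
  proof (intro ballI conjI allI)
    fix x assume "x \<in> S"
    then show "inner_product (pullback_metric h \<psi> x)"
      using h im has_derivative_linear[OF d\<psi>(1)] inj
      by (intro pullback_inner_product) (auto simp: metric_on_def)
  qed (rule exI, rule der)
qed

text \<open>The differential of \<open>\<psi>\<close> maps the intrinsic Christoffel term to the tangential part of the
  ambient covariant derivative. Indeed, expanding the Koszul formula of the induced metric with the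
  Leibniz rule, all second derivatives of \<open>\<psi>\<close> cancel by symmetry except
  \<open>2 h(D\<^sup>2\<psi>(v, w), D\<psi> u)\<close>, and what remains is the ambient Koszul formula. So the difference of
  the ambient covariant derivative and the image of the intrinsic term is orthogonal to the tangent
  space, that is, it is the normal part.\<close>
lemma gauss_formula:
  fixes h :: "'b::euclidean_space metric" and \<psi> :: "'a::euclidean_space \<Rightarrow> 'b"
  assumes S: "open S" "x \<in> S" and W: "open W" and im: "\<psi> ` S \<subseteq> W"
    and h: "metric_on W h" and \<psi>: "Ck_on 2 S \<psi>"
    and inj: "\<And>x. x \<in> S \<Longrightarrow> inj (frechet_derivative \<psi> (at x))"
  shows "second_derivative \<psi> x v w
      + christoffel h (\<psi> x) (frechet_derivative \<psi> (at x) v) (frechet_derivative \<psi> (at x) w)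
    = frechet_derivative \<psi> (at x) (christoffel (pullback_metric h \<psi>) x v w)
      + second_fundamental_form h \<psi> x v w"
proof -
  define P where "P = frechet_derivative \<psi> (at x)"
  define Q where "Q v w = second_derivative \<psi> x v w" for v w
  define g where "g = pullback_metric h \<psi>"
  define X where "X = Q v w + christoffel h (\<psi> x) (P v) (P w)"
  define N where "N = X - P (christoffel g x v w)"
  have \<psi>x: "\<psi> x \<in> W" using im S by auto
  have ip: "inner_product (h (\<psi> x))" using h \<psi>x by (simp add: metric_on_def)
  then have bl: "bilinear (h (\<psi> x))" and sym: "\<And>a b. h (\<psi> x) a b = h (\<psi> x) b a"
    by (auto simp: inner_product_def)
  have linP: "linear P"
    unfolding P_def by (rule has_derivative_linear[OF C2_on_derivatives(1)[OF \<psi> S(2)]])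
  have Qsym: "Q a b = Q b a" for a b
    unfolding Q_def by (rule second_derivative_sym[OF S \<psi>])
  have g: "metric_on S g" unfolding g_def by (rule metric_on_pullback[OF S(1) W im h \<psi> inj])
  have dg: "frechet_derivative (\<lambda>y. g y a b) (at x) u =
      frechet_derivative (\<lambda>z. h z (P a) (P b)) (at (\<psi> x)) (P u)
        + h (\<psi> x) (Q u a) (P b) + h (\<psi> x) (P a) (Q u b)" for a b u
    using frechet_derivative_at[OF pullback_metric_has_derivative[OF S(1) W im h \<psi> S(2), of a b], THEN fun_cong, of u]
    by (simp add: g_def P_def Q_def)
  have orth: "h (\<psi> x) N (P u) = 0" for u
  proof -
    have "2 * g x (christoffel g x v w) u
      = 2 * h (\<psi> x) (christoffel h (\<psi> x) (P v) (P w)) (P u) + 2 * h (\<psi> x) (Q v w) (P u)"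
      unfolding koszul[OF g S] koszul[OF h W \<psi>x] dg
      using sym[of "P w" "Q v u"] sym[of "P v" "Q w u"] sym[of "P v" "Q u w"]
      by (simp add: Qsym[of w v] Qsym[of u v] Qsym[of u w])
    then show ?thesis
      by (simp add: N_def X_def bilinear_lsub[OF bl] bilinear_ladd[OF bl] g_def
          pullback_metric_def P_def)
  qed
  have "normal_part (h (\<psi> x)) (range P) X = N"
    by (rule normal_part_eqI[OF ip]) (use orth linP in \<open>auto simp: N_def linear_subspace_image\<close>)
  then have "second_fundamental_form h \<psi> x v w = N"
    by (simp add: second_fundamental_form_def X_def Q_def P_def)
  then show ?thesis by (simp add: N_def X_def Q_def P_def g_def)
qed

text \<open>Restricting a function to an immersed submanifold changes its Hessian by the derivative in the
  direction of the second fundamental form: combine the chain rule with the Gauss formula.\<close>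
lemma hessian_compose_immersion:
  fixes h :: "'b::euclidean_space metric" and \<psi> :: "'a::euclidean_space \<Rightarrow> 'b"
  assumes S: "open S" "x \<in> S" and W: "open W" and im: "\<psi> ` S \<subseteq> W"
    and h: "metric_on W h" and \<psi>: "Ck_on 2 S \<psi>" and G: "Ck_on 2 W G"
    and inj: "\<And>x. x \<in> S \<Longrightarrow> inj (frechet_derivative \<psi> (at x))"
  shows "hessian (pullback_metric h \<psi>) (G \<circ> \<psi>) x v w
    = hessian h G (\<psi> x) (frechet_derivative \<psi> (at x) v) (frechet_derivative \<psi> (at x) w)
      + frechet_derivative G (at (\<psi> x)) (second_fundamental_form h \<psi> x v w)"
proof -
  have \<psi>x: "\<psi> x \<in> W" using im S by auto
  have lin: "linear (frechet_derivative G (at (\<psi> x)))"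
    by (rule has_derivative_linear[OF C2_on_derivatives(1)[OF G \<psi>x]])
  have "frechet_derivative G (at (\<psi> x)) (second_derivative \<psi> x v w)
     + frechet_derivative G (at (\<psi> x)) (christoffel h (\<psi> x) (frechet_derivative \<psi> (at x) v) (frechet_derivative \<psi> (at x) w))
    = frechet_derivative G (at (\<psi> x)) (frechet_derivative \<psi> (at x) (christoffel (pullback_metric h \<psi>) x v w))
      + frechet_derivative G (at (\<psi> x)) (second_fundamental_form h \<psi> x v w)"
    using arg_cong[OF gauss_formula[OF S W im h \<psi> inj, of v w], of "frechet_derivative G (at (\<psi> x))"]
    by (simp add: linear_add[OF lin])
  then show ?thesis
    unfolding hessian_def C2_on_compose(2)[OF S(1) W im \<psi> G S(2)]
      C2_on_compose(3)[OF S(1) W im \<psi> G S(2)] by linarith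
qed

section \<open>Hyperbolic space times the line\<close>

lemma hyp_line_pos:
  assumes "z \<in> hyp_line" shows "0 < 1 - fst z \<bullet> fst z"
proof -
  have "norm (fst z) < 1" using assms by (auto simp: hyp_line_def hyp_space_def)
  then show ?thesis by (simp add: dot_square_norm abs_square_less_1)
qed

lemma open_hyp_line: "open hyp_line"
  by (simp add: hyp_line_def hyp_space_def open_Times)

text \<open>In terms of this weight \<open>\<rho>\<close>, metric, Christoffel term and test function are polynomial: the conformal factor of the
  Poincare metric is \<open>4 \<rho>\<^sup>2\<close>, the derivative of \<open>\<rho>\<close> is \<open>2 \<rho>\<^sup>2 \<langle>x, \<cdot>\<rangle>\<close>, and \<open>\<rho> \<bar>x\<bar>\<^sup>2 = \<rho> - 1\<close>.\<close>
definition ball_weight :: "'a::euclidean_space \<times> real \<Rightarrow> real" where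
  "ball_weight z = 1 / (1 - fst z \<bullet> fst z)"

lemma ball_weight:
  fixes z :: "'a::euclidean_space \<times> real"
  assumes "z \<in> hyp_line"
  shows "ball_weight z > 0" "ball_weight z * (fst z \<bullet> fst z) = ball_weight z - 1"
    and "(ball_weight has_derivative (\<lambda>v. 2 * (ball_weight z)\<^sup>2 * (fst z \<bullet> fst v))) (at z)"
proof -
  note s = hyp_line_pos[OF assms]
  show "ball_weight z > 0" "ball_weight z * (fst z \<bullet> fst z) = ball_weight z - 1"
    using s by (auto simp: ball_weight_def field_simps)
  have "((\<lambda>y. 1 - fst y \<bullet> fst y) has_derivative (\<lambda>v. - 2 * (fst z \<bullet> fst v))) (at z)"
    by (auto intro!: derivative_eq_intros simp: inner_commute)
  from Deriv.has_derivative_inverse[OF _ this] s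
  have "((\<lambda>y. inverse (1 - fst y \<bullet> fst y)) has_derivative
    (\<lambda>v. - (inverse (1 - fst z \<bullet> fst z) * (- 2 * (fst z \<bullet> fst v)) * inverse (1 - fst z \<bullet> fst z)))) (at z)"
    by simp
  moreover have "ball_weight = (\<lambda>y::'a \<times> real. inverse (1 - fst y \<bullet> fst y))"
    by (simp add: fun_eq_iff ball_weight_def inverse_eq_divide)
  ultimately have "(ball_weight has_derivative
    (\<lambda>v. - (inverse (1 - fst z \<bullet> fst z) * (- 2 * (fst z \<bullet> fst v)) * inverse (1 - fst z \<bullet> fst z)))) (at z)"
    by simp
  then show "(ball_weight has_derivative (\<lambda>v. 2 * (ball_weight z)\<^sup>2 * (fst z \<bullet> fst v))) (at z)"
    by (rule has_derivative_eq_rhs) (simp add: fun_eq_iff ball_weight_def inverse_eq_divide power2_eq_square)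
qed

lemma hyp_line_metric_alt:
  "hyp_line_metric z v w = 4 * (ball_weight z)\<^sup>2 * (fst v \<bullet> fst w) + snd v * snd w"
  by (simp add: hyp_line_metric_def hyp_metric_def dot_square_norm ball_weight_def power_divide)

lemma inner_product_hyp_line:
  assumes z: "z \<in> hyp_line"
  shows "inner_product (hyp_line_metric z)"
proof -
  have s: "0 < 4 * (ball_weight z)\<^sup>2" using ball_weight(1)[OF z] by simp
  have "hyp_line_metric z v v > 0" if "v \<noteq> 0" for v
  proof (cases "fst v = 0")
    case True
    then have "snd v \<noteq> 0" using that by (simp add: prod_eq_iff)
    then have "0 < snd v * snd v" by (metis not_real_square_gt_zero)
    then show ?thesis using True by (simp add: hyp_line_metric_alt)
  next
    case False
    then have "0 < 4 * (ball_weight z)\<^sup>2 * (fst v \<bullet> fst v)"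
      using s by (intro mult_pos_pos) auto
    then show ?thesis
      unfolding hyp_line_metric_alt by (intro add_pos_nonneg) auto
  qed
  moreover have "bilinear (hyp_line_metric z)"
    unfolding bilinear_def hyp_line_metric_alt
    by (auto intro!: linearI simp: inner_add_left inner_add_right algebra_simps)
  ultimately show ?thesis
    by (simp add: inner_product_def hyp_line_metric_alt inner_commute mult.commute)
qed

lemma hyp_line_metric_derivative:
  assumes z: "z \<in> hyp_line"
  shows "((\<lambda>y. hyp_line_metric y a b) has_derivative
    (\<lambda>c. 16 * (ball_weight z)^3 * (fst z \<bullet> fst c) * (fst a \<bullet> fst b))) (at z)"
  unfolding hyp_line_metric_alt
  by (rule has_derivative_eq_rhs[OF has_derivative_add[OF has_derivative_mult_left[OF
        has_derivative_mult_right[OF has_derivative_power[OF ball_weight(3)[OF z]]]] has_derivative_const]])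
     (simp add: fun_eq_iff power2_eq_square power3_eq_cube)

lemma metric_on_hyp_line: "metric_on hyp_line hyp_line_metric"
  unfolding metric_on_def differentiable_def
  by (intro ballI conjI allI inner_product_hyp_line) (assumption, rule exI, rule hyp_line_metric_derivative)

text \<open>The Christoffel term of a conformally flat metric; the line contributes nothing, because its
  factor is flat and does not interact with the hyperbolic one.\<close>
lemma christoffel_hyp_line:
  assumes z: "z \<in> hyp_line"
  shows "christoffel hyp_line_metric z a b =
    ((2 * ball_weight z) *\<^sub>R ((fst z \<bullet> fst a) *\<^sub>R fst b + (fst z \<bullet> fst b) *\<^sub>R fst a
        - (fst a \<bullet> fst b) *\<^sub>R fst z), 0)" (is "_ = ?\<Gamma>")
proof (rule inner_product_cancel[OF inner_product_hyp_line[OF z]])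
  fix u :: "'a \<times> real"
  have d: "frechet_derivative (\<lambda>y. hyp_line_metric y a b) (at z) c =
     16 * (ball_weight z)^3 * (fst z \<bullet> fst c) * (fst a \<bullet> fst b)" for a b c :: "'a \<times> real"
    using frechet_derivative_at[OF hyp_line_metric_derivative[OF z], of a b] by metis
  have "2 * hyp_line_metric z (christoffel hyp_line_metric z a b) u
    = 16 * (ball_weight z)^3 * ((fst z \<bullet> fst a) * (fst b \<bullet> fst u)
        + (fst z \<bullet> fst b) * (fst a \<bullet> fst u) - (fst z \<bullet> fst u) * (fst a \<bullet> fst b))"
    by (simp only: koszul[OF metric_on_hyp_line open_hyp_line z] d) (simp add: algebra_simps)
  also have "\<dots> = 2 * hyp_line_metric z ?\<Gamma> u"
    unfolding hyp_line_metric_alt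
    by (simp add: inner_add_left inner_diff_left power2_eq_square power3_eq_cube)
  finally show "hyp_line_metric z (christoffel hyp_line_metric z a b) u = hyp_line_metric z ?\<Gamma> u" by simp
qed

text \<open>On \<^const>\<open>hyp_line\<close> this is \<open>(1 + \<bar>x\<bar>\<^sup>2) / (1 - \<bar>x\<bar>\<^sup>2)\<close>, the hyperbolic cosine of the hyperbolic distance
  of the first component \<open>x\<close> to the centre of the ball.\<close>
definition cosh_radius :: "'a::euclidean_space \<times> real \<Rightarrow> real" where
  "cosh_radius z = 2 * ball_weight z - 1"

lemma
  fixes z v w :: "'a::euclidean_space \<times> real"
  shows C2_on_cosh_radius: "Ck_on 2 hyp_line (cosh_radius :: 'a \<times> real \<Rightarrow> real)"
    and cosh_radius_derivative: "z \<in> hyp_line \<Longrightarrow> frechet_derivative cosh_radius (at z) v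
        = 4 * (ball_weight z)\<^sup>2 * (fst z \<bullet> fst v)"
    and cosh_radius_second_derivative: "z \<in> hyp_line \<Longrightarrow> second_derivative cosh_radius z v w
        = 4 * (ball_weight z)\<^sup>2 * (fst v \<bullet> fst w)
          + 16 * (ball_weight z)^3 * (fst z \<bullet> fst v) * (fst z \<bullet> fst w)"
proof -
  have D: "(cosh_radius has_derivative (\<lambda>v. 4 * (ball_weight z)\<^sup>2 * (fst z \<bullet> fst v))) (at z)"
    if "z \<in> hyp_line" for z :: "'a \<times> real"
    unfolding cosh_radius_def[abs_def]
    by (rule has_derivative_eq_rhs[OF has_derivative_diff[OF
          has_derivative_mult_right[OF ball_weight(3)[OF that]] has_derivative_const]]) (simp add: fun_eq_iff)
  have D2: "((\<lambda>y. 4 * (ball_weight y)\<^sup>2 * (fst y \<bullet> fst w)) has_derivative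
      (\<lambda>v. 4 * (ball_weight z)\<^sup>2 * (fst v \<bullet> fst w)
          + 16 * (ball_weight z)^3 * (fst z \<bullet> fst v) * (fst z \<bullet> fst w))) (at z)"
    if "z \<in> hyp_line" for z w :: "'a \<times> real"
    by (rule has_derivative_eq_rhs[OF has_derivative_mult[OF
          has_derivative_mult_right[OF has_derivative_power[OF ball_weight(3)[OF that]]]
          has_derivative_inner_left[OF has_derivative_fst[OF has_derivative_ident]]]])
       (simp add: fun_eq_iff power2_eq_square power3_eq_cube)
  have cw: "continuous_on hyp_line (ball_weight :: 'a \<times> real \<Rightarrow> real)"
    unfolding ball_weight_def by (intro continuous_intros) (auto dest: hyp_line_pos)
  have cont: "continuous_on hyp_line (\<lambda>z::'a \<times> real. 4 * (ball_weight z)\<^sup>2 * (fst v \<bullet> fst w)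
          + 16 * (ball_weight z)^3 * (fst z \<bullet> fst v) * (fst z \<bullet> fst w))" for v w :: "'a \<times> real"
    by (intro continuous_intros cw)
  note * = C2_onI[OF open_hyp_line D D2 cont]
  show "Ck_on 2 hyp_line (cosh_radius :: 'a \<times> real \<Rightarrow> real)" by (rule *(1))
  show "z \<in> hyp_line \<Longrightarrow> frechet_derivative cosh_radius (at z) v
        = 4 * (ball_weight z)\<^sup>2 * (fst z \<bullet> fst v)" by (simp add: *(2))
  show "z \<in> hyp_line \<Longrightarrow> second_derivative cosh_radius z v w
        = 4 * (ball_weight z)\<^sup>2 * (fst v \<bullet> fst w)
          + 16 * (ball_weight z)^3 * (fst z \<bullet> fst v) * (fst z \<bullet> fst w)"
    by (rule *(3))
qed

text \<open>In hyperbolic space the Hessian of \<open>cosh r\<close> is \<open>cosh r\<close> times the metric; on the product, the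
  vertical part of the metric has to be removed.\<close>
lemma hessian_cosh_radius:
  assumes z: "z \<in> hyp_line"
  shows "hessian hyp_line_metric cosh_radius z v w =
    cosh_radius z * (hyp_line_metric z v w - snd v * snd w)"
proof -
  define \<rho> where "\<rho> = ball_weight z"
  define X where "X = fst z \<bullet> fst z"
  have \<rho>: "\<rho> * X = \<rho> - 1" using ball_weight(2)[OF z] by (simp add: \<rho>_def X_def)
  have "hessian hyp_line_metric cosh_radius z v w
    = 4 * \<rho>\<^sup>2 * (fst v \<bullet> fst w) + 16 * \<rho>^3 * (fst z \<bullet> fst v) * (fst z \<bullet> fst w)
      - 4 * \<rho>\<^sup>2 * (2 * \<rho> * (2 * ((fst z \<bullet> fst v) * (fst z \<bullet> fst w)) - (fst v \<bullet> fst w) * X))"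
    unfolding hessian_def christoffel_hyp_line[OF z] cosh_radius_derivative[OF z]
      cosh_radius_second_derivative[OF z]
    by (simp add: inner_add_right inner_diff_right \<rho>_def X_def mult.commute)
  also have "\<dots> = 4 * \<rho>\<^sup>2 * (fst v \<bullet> fst w) * (1 + 2 * (\<rho> * X))"
    by (simp add: algebra_simps power2_eq_square power3_eq_cube)
  also have "\<dots> = cosh_radius z * (hyp_line_metric z v w - snd v * snd w)"
    unfolding \<rho> by (simp add: hyp_line_metric_alt cosh_radius_def \<rho>_def)
  finally show ?thesis .
qed

text \<open>The gradient of \<open>cosh r\<close> has length \<open>sinh r\<close>, which is the coefficient
  \<open>2 \<bar>x\<bar> / (1 - \<bar>x\<bar>\<^sup>2)\<close> here.\<close>
lemma cosh_radius_gradient_bound: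
  assumes z: "z \<in> hyp_line"
  shows "\<bar>frechet_derivative cosh_radius (at z) V\<bar>
    \<le> 2 * ball_weight z * norm (fst z) * sqrt (hyp_line_metric z V V)"
proof -
  define \<rho> where "\<rho> = ball_weight z"
  have \<rho>: "\<rho> > 0" using ball_weight(1)[OF z] by (simp add: \<rho>_def)
  have "(2 * \<rho> * norm (fst V))\<^sup>2 \<le> hyp_line_metric z V V"
    by (simp add: hyp_line_metric_alt \<rho>_def power_mult_distrib dot_square_norm)
  then have V: "2 * \<rho> * norm (fst V) \<le> sqrt (hyp_line_metric z V V)" by (rule real_le_rsqrt)
  have "\<bar>frechet_derivative cosh_radius (at z) V\<bar> = 4 * \<rho>\<^sup>2 * \<bar>fst z \<bullet> fst V\<bar>"
    by (simp add: cosh_radius_derivative[OF z] \<rho>_def abs_mult)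
  also have "\<dots> \<le> 4 * \<rho>\<^sup>2 * (norm (fst z) * norm (fst V))"
    by (intro mult_left_mono Cauchy_Schwarz_ineq2) simp
  also have "\<dots> = 2 * \<rho> * norm (fst z) * (2 * \<rho> * norm (fst V))"
    by (simp add: power2_eq_square)
  also have "\<dots> \<le> 2 * \<rho> * norm (fst z) * sqrt (hyp_line_metric z V V)"
    using \<rho> by (intro mult_left_mono V) simp
  finally show ?thesis by (simp add: \<rho>_def)
qed

text \<open>With \<open>n\<close> the dimension, the trace of the Hessian over an orthonormal frame of the hypersurface
  is \<open>cosh r (n - \<Sigma>\<langle>e\<^sub>i, \<partial>\<^sub>t\<rangle>\<^sup>2)\<close> plus the derivative in the direction of the mean curvature vector.
  Bessel's inequality for the unit vector \<open>\<partial>\<^sub>t\<close> bounds the first term below by \<open>(n - 1) cosh r\<close>, and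
  the curvature bound limits the second to \<open>(n - 1) sinh r\<close>. The difference
  \<open>(n - 1) (cosh r - sinh r)\<close> is positive.\<close>
lemma trace_hessian_cosh_radius_pos:
  fixes \<psi> :: "'a::euclidean_space \<Rightarrow> 'a \<times> real"
  assumes n: "DIM('a) \<ge> 2" and S: "open S" "x \<in> S" and im: "\<psi> ` S \<subseteq> hyp_line"
    and \<psi>: "Ck_on 2 S \<psi>" and inj: "\<And>x. x \<in> S \<Longrightarrow> inj (frechet_derivative \<psi> (at x))"
    and V: "V = metric_trace (pullback_metric hyp_line_metric \<psi> x)
        (second_fundamental_form hyp_line_metric \<psi> x)"
    and H: "sqrt (hyp_line_metric (\<psi> x) V V) \<le> real DIM('a) - 1"
  shows "metric_trace (pullback_metric hyp_line_metric \<psi> x)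
    (hessian (pullback_metric hyp_line_metric \<psi>) (cosh_radius \<circ> \<psi>) x) > 0"
proof -
  define z where "z = \<psi> x"
  define P where "P = frechet_derivative \<psi> (at x)"
  define b where "b = pullback_metric hyp_line_metric \<psi> x"
  define E where "E = (SOME E. orthonormal_basis b E)"
  define n where "n = real DIM('a)"
  define \<rho> where "\<rho> = ball_weight z"
  define DG where "DG = frechet_derivative cosh_radius (at z)"
  have z: "z \<in> hyp_line" using im S by (auto simp: z_def)
  have \<rho>: "\<rho> > 0" "\<rho> * (norm (fst z))\<^sup>2 = \<rho> - 1"
    using ball_weight(1,2)[OF z] by (simp_all add: \<rho>_def dot_square_norm)
  have "inner_product b"
    using metric_on_pullback[OF S(1) open_hyp_line im metric_on_hyp_line \<psi> inj] S(2)
    by (simp add: metric_on_def b_def)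
  then have "orthonormal_basis b E" unfolding E_def by (rule orthonormal_basis_some)
  then have E: "finite E" "card E = DIM('a)"
      "\<And>e e'. e \<in> E \<Longrightarrow> e' \<in> E \<Longrightarrow> hyp_line_metric z (P e) (P e') = (if e = e' then 1 else 0)"
    by (auto simp: orthonormal_basis_def b_def pullback_metric_def P_def z_def)
  have linDG: "linear DG"
    unfolding DG_def by (rule has_derivative_linear[OF C2_on_derivatives(1)[OF C2_on_cosh_radius z]])
  have "(\<Sum>e\<in>E. (hyp_line_metric z (0, 1) (P e))\<^sup>2) \<le> hyp_line_metric z (0, 1) (0, 1)"
    by (rule inner_product_bessel[OF inner_product_hyp_line[OF z] E(1)]) (rule E(3))
  then have vertical: "(\<Sum>e\<in>E. snd (P e) * snd (P e)) \<le> 1"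
    by (simp add: hyp_line_metric_alt power2_eq_square)
  have "metric_trace b (hessian (pullback_metric hyp_line_metric \<psi>) (cosh_radius \<circ> \<psi>) x)
    = (\<Sum>e\<in>E. cosh_radius z * (1 - snd (P e) * snd (P e))
        + DG (second_fundamental_form hyp_line_metric \<psi> x e e))"
    unfolding metric_trace_def E_def[symmetric]
    by (intro sum.cong refl, subst hessian_compose_immersion[OF S open_hyp_line im metric_on_hyp_line
          \<psi> C2_on_cosh_radius inj])
       (simp_all add: hessian_cosh_radius[OF z] E(3) flip: P_def z_def DG_def)
  also have "\<dots> = cosh_radius z * (n - (\<Sum>e\<in>E. snd (P e) * snd (P e))) + DG V"
    by (simp add: V metric_trace_def sum.distrib linear_sum[OF linDG] E(2) n_def sum_subtractf
        flip: sum_distrib_left b_def E_def)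
  also have "\<dots> > 0"
  proof -
    have r: "norm (fst z) < 1" using z by (auto simp: hyp_line_def hyp_space_def)
    have cosh: "cosh_radius z = \<rho> * (1 + (norm (fst z))\<^sup>2)"
      using \<rho>(2) by (simp add: cosh_radius_def \<rho>_def distrib_left)
    have "\<bar>DG V\<bar> \<le> 2 * \<rho> * norm (fst z) * sqrt (hyp_line_metric z V V)"
      unfolding DG_def \<rho>_def by (rule cosh_radius_gradient_bound[OF z])
    also have "\<dots> \<le> 2 * \<rho> * norm (fst z) * (n - 1)"
      using H \<rho> by (intro mult_left_mono) (auto simp: z_def n_def)
    finally have "DG V \<ge> - (2 * \<rho> * norm (fst z) * (n - 1))" by simp
    moreover have "cosh_radius z * (n - (\<Sum>e\<in>E. snd (P e) * snd (P e))) \<ge> cosh_radius z * (n - 1)"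
      using vertical \<rho> by (intro mult_left_mono) (auto simp: cosh)
    moreover have "cosh_radius z * (n - 1) - 2 * \<rho> * norm (fst z) * (n - 1)
        = \<rho> * (1 - norm (fst z))\<^sup>2 * (n - 1)"
      by (simp add: cosh power2_eq_square algebra_simps)
    moreover have "\<rho> * (1 - norm (fst z))\<^sup>2 * (n - 1) > 0"
      using \<rho> r assms(1) by (simp add: n_def)
    ultimately show ?thesis by linarith
  qed
  finally show ?thesis by (simp add: b_def)
qed

section \<open>Cylindrically bounded submanifolds\<close>

text \<open>The function \<open>- ln (1 - \<bar>x\<bar>\<^sup>2)\<close> is 1-Lipschitz for the hyperbolic metric, because its Euclidean
  gradient has norm \<open>2 \<bar>x\<bar> / (1 - \<bar>x\<bar>\<^sup>2)\<close>, at most the conformal stretch \<open>2 / (1 - \<bar>x\<bar>\<^sup>2)\<close>. Unlike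
  the distance itself it is smooth, and it blows up at the boundary sphere, so it suffices to
  confine hyperbolically bounded sets to a smaller ball.\<close>
lemma hyp_dist_lower_bound:
  fixes x y :: "'a::euclidean_space"
  shows "ennreal (ln (1 - x \<bullet> x) - ln (1 - y \<bullet> y)) \<le> hyp_dist x y"
  unfolding hyp_dist_def riemannian_dist_def
proof (rule INF_greatest)
  fix \<gamma> :: "real \<Rightarrow> 'a"
  assume "\<gamma> \<in> {\<gamma>. piecewise_C1_curve (top_of_set hyp_space) {(hyp_space, id)} \<gamma> \<and> \<gamma> 0 = x \<and> \<gamma> 1 = y}"
  then have \<gamma>: "piecewise_C1_curve (top_of_set hyp_space) {(hyp_space, id)} \<gamma>" "\<gamma> 0 = x" "\<gamma> 1 = y"
    by auto
  then have "pathin (top_of_set hyp_space) \<gamma>" by (simp add: piecewise_C1_curve_def)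
  then have cont: "continuous_on {0..1} \<gamma>" and im: "\<And>t. t \<in> {0..1} \<Longrightarrow> \<gamma> t \<in> hyp_space"
    by (auto simp: pathin_def continuous_map_in_subtopology)
  obtain K where K: "finite K"
      "(id \<circ> \<gamma>) C1_differentiable_on {t \<in> {0<..<1} - K. \<gamma> t \<in> hyp_space}"
    using \<gamma>(1) by (auto simp: piecewise_C1_curve_def)
  define U where "U = {0<..<1} - K"
  have U: "open U" "U \<subseteq> {0..1}" using K(1) by (auto simp: U_def intro: open_Diff finite_imp_closed)
  have "{t \<in> {0<..<1} - K. \<gamma> t \<in> hyp_space} = U" using im by (auto simp: U_def)
  then obtain D where D: "\<And>t. t \<in> U \<Longrightarrow> (\<gamma> has_vector_derivative D t) (at t)" "continuous_on U D"
    using K(2) by (auto simp: C1_differentiable_on_def)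
  have pos: "0 < 1 - \<gamma> t \<bullet> \<gamma> t" if "t \<in> {0..1}" for t
    using hyp_line_pos[of "(\<gamma> t, 0)"] im[OF that] by (simp add: hyp_line_def)
  define f where "f t = - ln (1 - \<gamma> t \<bullet> \<gamma> t)" for t
  define f' where "f' t = 2 * (\<gamma> t \<bullet> D t) / (1 - \<gamma> t \<bullet> \<gamma> t)" for t
  define k where "k t = indicator U t * f' t" for t
  have k_int: "(k has_integral (f 1 - f 0)) {0..1}"
  proof (rule fundamental_theorem_of_calculus_interior_strong[OF K(1)])
    show "continuous_on {0..1} f"
      unfolding f_def using pos by (intro continuous_intros cont) force
    fix t assume t: "t \<in> {0<..<1} - K"
    then have tU: "t \<in> U" and tI: "t \<in> {0..1}" by (auto simp: U_def)
    have d: "(\<gamma> has_derivative (\<lambda>r. r *\<^sub>R D t)) (at t)"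
      using D(1)[OF tU] by (simp add: has_vector_derivative_def)
    have "(f has_derivative (\<lambda>r. r * f' t)) (at t)"
      unfolding f_def
      using pos[OF tI]
      by (intro has_derivative_eq_rhs[OF has_derivative_minus[OF has_derivative_ln[OF _
            has_derivative_diff[OF has_derivative_const has_derivative_inner[OF d d]]]]])
         (auto simp: f'_def fun_eq_iff inner_commute field_simps)
    then show "(f has_vector_derivative k t) (at t)"
      using tU by (simp add: has_vector_derivative_def k_def)
  qed simp
  have k_bound: "ennreal \<bar>k t\<bar> \<le> ennreal (speed {(hyp_space, id)} (\<lambda>_. hyp_metric) \<gamma> t) * indicator {0..1} t"
    for t
  proof (cases "t \<in> U")
    case True
    then have t: "t \<in> {0..1}" using U by auto
    have c: "chart_at {(hyp_space, id)} (\<gamma> t) = (hyp_space, id)"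
      unfolding chart_at_def by (rule some_equality) (use im[OF t] in auto)
    have "\<bar>k t\<bar> = 2 / (1 - \<gamma> t \<bullet> \<gamma> t) * \<bar>\<gamma> t \<bullet> D t\<bar>"
      using True pos[OF t] by (simp add: k_def f'_def abs_mult)
    also have "\<dots> \<le> 2 / (1 - \<gamma> t \<bullet> \<gamma> t) * (1 * norm (D t))"
      using pos[OF t] im[OF t]
      by (intro mult_left_mono order_trans[OF Cauchy_Schwarz_ineq2] mult_right_mono)
         (auto simp: hyp_space_def)
    also have "\<dots> = sqrt (hyp_metric (\<gamma> t) (D t) (D t))"
      using pos[OF t]
      by (intro real_sqrt_unique[symmetric])
         (auto simp: hyp_metric_def power_mult_distrib power_divide dot_square_norm)
    also have "\<dots> = speed {(hyp_space, id)} (\<lambda>_. hyp_metric) \<gamma> t"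
      using vector_derivative_at[OF D(1)[OF True]] by (simp add: speed_def c Let_def)
    finally show ?thesis using t by (simp add: ennreal_leI)
  next
    case False
    then show ?thesis by (simp add: k_def)
  qed
  have k_meas: "k \<in> borel_measurable borel"
  proof -
    have "continuous_on U f'"
      unfolding f'_def using pos U(2)
      by (intro continuous_intros D(2) continuous_on_subset[OF cont]) force+
    then have "(\<lambda>t. indicator U t *\<^sub>R f' t) \<in> borel_measurable borel"
      by (rule borel_measurable_continuous_on_indicator[OF borel_open[OF U(1)]])
    then show ?thesis unfolding k_def[abs_def] by simp
  qed
  have "ennreal (f 1 - f 0) \<le> (\<integral>\<^sup>+t. ennreal \<bar>k t\<bar> \<partial>lborel)"
  \<comment> \<open>The derivative may be unbounded near the break points. If its absolute integral is infinite,
    so is the length; otherwise the Lebesgue integral is also a gauge integral, for which the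
    fundamental theorem holds with finitely many exceptional points.\<close>
  proof (cases "\<integral>\<^sup>+t. ennreal \<bar>k t\<bar> \<partial>lborel")
    case (real r)
    have "((\<lambda>t. \<bar>k t\<bar>) has_integral r) UNIV"
      by (rule nn_integral_has_integral) (use real k_meas in auto)
    moreover have "(\<lambda>t. \<bar>k t\<bar>) = (\<lambda>t. if t \<in> {0..1} then \<bar>k t\<bar> else 0)"
      using U(2) by (auto simp: k_def indicator_def fun_eq_iff)
    ultimately have "((\<lambda>t. \<bar>k t\<bar>) has_integral r) {0..1}"
      using has_integral_restrict_UNIV[of "{0..1}" "\<lambda>t. \<bar>k t\<bar>" r] by simp
    then have "f 1 - f 0 \<le> r"
      by (rule has_integral_le[OF k_int]) simp
    then show ?thesis using real by (simp add: ennreal_leI)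
  qed simp
  also have "\<dots> \<le> curve_length {(hyp_space, id)} (\<lambda>_. hyp_metric) \<gamma>"
    unfolding curve_length_def by (intro nn_integral_mono k_bound)
  finally show "ennreal (ln (1 - x \<bullet> x) - ln (1 - y \<bullet> y))
      \<le> curve_length {(hyp_space, id)} (\<lambda>_. hyp_metric) \<gamma>"
    by (simp add: f_def \<gamma>)
qed

lemma cosh_radius_bounded:
  assumes F: "F ` topspace M \<subseteq> hyp_line" and cyl: "cylindrically_bounded M F"
  shows "bdd_above ((cosh_radius \<circ> F) ` topspace M)"
proof -
  obtain x\<^sub>0 R where x0: "x\<^sub>0 \<in> hyp_space"
      and R: "\<And>y. y \<in> fst ` F ` topspace M \<Longrightarrow> hyp_dist x\<^sub>0 y \<le> ennreal R"
    using cyl by (auto simp: cylindrically_bounded_def)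
  \<comment> \<open>\<open>R\<close> is replaced by its positive part, as a negative real is truncated to \<open>0\<close> in \<open>[0, \<infinity>]\<close>.\<close>
  define m where "m = exp (ln (1 - x\<^sub>0 \<bullet> x\<^sub>0) - max 0 R)"
  have "cosh_radius (F p) \<le> 2 / m - 1" if p: "p \<in> topspace M" for p
  proof -
    define y where "y = fst (F p)"
    have y: "0 < 1 - y \<bullet> y" using F p hyp_line_pos[of "F p"] by (auto simp: y_def)
    have "ennreal (ln (1 - x\<^sub>0 \<bullet> x\<^sub>0) - ln (1 - y \<bullet> y)) \<le> ennreal R"
      using hyp_dist_lower_bound R p by (force simp: y_def intro: order_trans)
    then have "ln (1 - x\<^sub>0 \<bullet> x\<^sub>0) - ln (1 - y \<bullet> y) \<le> max 0 R"
      by (cases "0 \<le> R") (auto simp: ennreal_le_iff ennreal_neg)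
    then have "ln (1 - x\<^sub>0 \<bullet> x\<^sub>0) - max 0 R \<le> ln (1 - y \<bullet> y)" by linarith
    then have "m \<le> exp (ln (1 - y \<bullet> y))" by (simp only: m_def exp_le_cancel_iff)
    then have "m \<le> 1 - y \<bullet> y" using y by simp
    then have "2 / (1 - y \<bullet> y) \<le> 2 / m" by (intro frac_le) (simp_all add: m_def)
    then show ?thesis by (simp add: cosh_radius_def ball_weight_def y_def)
  qed
  then show ?thesis by (auto intro!: bdd_aboveI2)
qed

section \<open>Non-parabolicity\<close>

lemma hessian_of_constant:
  fixes x :: "'a::euclidean_space"
  assumes S: "open S" "x \<in> S" and f: "\<And>y. y \<in> S \<Longrightarrow> f y = k"
  shows "hessian g f x v w = 0"
proof -
  have d: "(f has_derivative (\<lambda>_. 0)) (at y)" if "y \<in> S" for y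
    by (rule has_derivative_transform_within_open[OF has_derivative_const S(1) that]) (simp add: f)
  have d2: "((\<lambda>_. 0) has_derivative (\<lambda>_. 0)) (at y)" for y :: 'a by simp
  note * = C2_onI[OF S(1) d d2 continuous_on_const]
  show ?thesis by (simp add: hessian_def *(2,3)[OF _ S(2)])
qed

theorem theorem1p3:
  fixes M :: "'m topology"
    and A :: "('m, 'a::euclidean_space) chart set"
    and F :: "'m \<Rightarrow> 'a \<times> real"
  assumes "DIM('a) \<ge> 2"
    and "smooth_manifold M A"
    and "connected_space M" and "topspace M \<noteq> {}"
    and "immersion M A hyp_line F"
    and "complete_riemannian M A (induced_metric hyp_line_metric F)"
    and "bdd_above (abs_mean_curvature A hyp_line_metric F ` topspace M)"
    and "(SUP p\<in>topspace M. abs_mean_curvature A hyp_line_metric F p)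
           \<le> (real DIM('a) - 1) / real DIM('a)"
    and "cylindrically_bounded M F"
  shows "non_parabolic M A (induced_metric hyp_line_metric F)"
proof -
  define u where "u = cosh_radius \<circ> F"
  let ?g = "induced_metric hyp_line_metric F :: ('m, 'a) manifold_metric"
  have atlas: "(\<Union>c\<in>A. fst c) = topspace M"
    and chart: "\<And>c. c \<in> A \<Longrightarrow> open (chart_image c) \<and> inj_on (snd c) (fst c)"
    using assms(2)
    by (auto simp: smooth_manifold_def smooth_atlas_def homeomorphic_eq_everything_map
        topspace_subtopology openin_subset Int_absorb1)
  have Fim: "F ` topspace M \<subseteq> hyp_line" using assms(5) by (simp add: immersion_def)
  have rep_u: "local_rep c u = cosh_radius \<circ> local_rep c F" for c :: "('m, 'a) chart"
    by (simp add: local_rep_def u_def comp_assoc)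
  have im: "local_rep c F ` chart_image c \<subseteq> hyp_line" if "c \<in> A" for c
    using Fim atlas that by (auto simp: local_rep_def intro!: inv_into_into)
  have C2: "Ck_on 2 (chart_image c) (local_rep c F)"
    and inj: "\<And>x. x \<in> chart_image c \<Longrightarrow> inj (frechet_derivative (local_rep c F) (at x))" if "c \<in> A" for c
    using assms(5) that by (auto simp: immersion_def smooth_on_def)
  \<comment> \<open>The Laplacian and the mean curvature vector are evaluated in the same chart and, having the same
    metric, over the same chosen orthonormal basis, so the pointwise estimate applies directly.\<close>
  have pos: "laplacian A ?g u p > 0" if p: "p \<in> topspace M" for p
  proof -
    define c where "c = chart_at A p"
    define x where "x = snd c p"
    define \<psi> where "\<psi> = local_rep c F"
    have "\<exists>c. c \<in> A \<and> p \<in> fst c" using p atlas by blast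
    then have c: "c \<in> A" "p \<in> fst c"
      unfolding c_def chart_at_def by (metis (mono_tags, lifting) someI_ex)+
    have x: "x \<in> chart_image c" using c by (auto simp: x_def)
    have \<psi>x: "\<psi> x = F p" using c chart[OF c(1)] by (simp add: \<psi>_def x_def local_rep_def)
    have "abs_mean_curvature A hyp_line_metric F p \<le> (real DIM('a) - 1) / real DIM('a)"
      using cSUP_upper[OF p assms(7)] assms(8) by linarith
    then have "sqrt (hyp_line_metric (\<psi> x)
        (metric_trace (pullback_metric hyp_line_metric \<psi> x) (second_fundamental_form hyp_line_metric \<psi> x))
        (metric_trace (pullback_metric hyp_line_metric \<psi> x) (second_fundamental_form hyp_line_metric \<psi> x)))
      \<le> real DIM('a) - 1"
      by (simp add: abs_mean_curvature_def mean_curvature_vector_def Let_def divide_le_cancel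
          \<psi>x flip: c_def x_def \<psi>_def)
    then have "metric_trace (pullback_metric hyp_line_metric \<psi> x)
      (hessian (pullback_metric hyp_line_metric \<psi>) (cosh_radius \<circ> \<psi>) x) > 0"
      using trace_hessian_cosh_radius_pos[OF assms(1) _ x im[OF c(1)] C2[OF c(1)] inj[OF c(1)] refl]
        chart[OF c(1)] by (simp add: \<psi>_def)
    then show ?thesis
      by (simp add: laplacian_def Let_def induced_metric_def rep_u flip: c_def x_def \<psi>_def)
  qed
  have "Ck_on 2 (chart_image c) (local_rep c u)" if "c \<in> A" for c
    unfolding rep_u using C2_on_compose(1)[OF _ open_hyp_line im[OF that] C2[OF that] C2_on_cosh_radius]
      chart[OF that] by blast
  then have "subharmonic M A ?g u"
    using pos by (auto simp: subharmonic_def Ck_function_def less_imp_le)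
  moreover have "bdd_above (u ` topspace M)"
    unfolding u_def by (rule cosh_radius_bounded[OF Fim assms(9)])
  moreover have "\<not> u constant_on topspace M"
  proof
    assume "u constant_on topspace M"
    then obtain k where k: "\<And>p. p \<in> topspace M \<Longrightarrow> u p = k" by (auto simp: constant_on_def)
    obtain p where p: "p \<in> topspace M" using assms(4) by blast
    define c where "c = chart_at A p"
    have "\<exists>c. c \<in> A \<and> p \<in> fst c" using p atlas by blast
    then have c: "c \<in> A" "p \<in> fst c"
      unfolding c_def chart_at_def by (metis (mono_tags, lifting) someI_ex)+
    have "local_rep c u y = k" if "y \<in> chart_image c" for y
      using k atlas c that by (auto simp: local_rep_def intro!: k inv_into_into)
    then have "hessian (?g c) (local_rep c u) (snd c p) v w = 0" for v w
      using chart[OF c(1)] c by (intro hessian_of_constant[where S="chart_image c"]) auto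
    then have "laplacian A ?g u p = 0"
      by (simp add: laplacian_def Let_def metric_trace_def flip: c_def)
    then show False using pos[OF p] by simp
  qed
  ultimately show ?thesis unfolding non_parabolic_def by blast
qed

end
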